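(* Let $L_0>0$ and consider a block spike and slab prior $\pi$ on $\ell^2(\Lambda)$ as defined in the context (with slab densities $g_j$, weights $\nu_{j,n}$, and constants $L_0$, $G$, $c$). If $Y^n$ is drawn from the Gaussian white noise sequence model, then for every $0<\beta_1\le\beta_2$ and every $L$ with $0<L\le L_0-1$ there exist constants $M,B>0$ such that, for all $\beta\in[\beta_1,\beta_2]$ and all $n\ge 2$, $$\sup_{\theta_0\in\mathcal H(\beta,L)}E^n_{\theta_0}\big[P^\pi\big(\theta:\ell_2(\theta,\theta_0)\ge M n^{-\beta/(2\beta+1)}\mid Y^n\big)\big]\le e^{-B\,n^{1/(2\beta+1)}}.$$
   Context: Index set: $\Lambda=\{(j,k): j\in\mathbb N=\{0,1,2,\dots\},\ k\in I_j\}$, where the $I_j$ are finite sets with $|I_j|$ of order $2^j$ (i.e. $c_12^j\le|I_j|\le c_22^j$ for fixed constants $0<c_1\le c_2$); $\Lambda$ indexes a compactly supported orthonormal wavelet basis of $L^2([0,1])$. The parameter space is $\ell^2(\Lambda)$. Gaussian white noise sequence model: under $P^n_{\theta}$, $\theta=(\theta_{j,k})\in\ell^2(\Lambda)$, one observes $Y^n=(Y_{j,k})_{(j,k)\in\Lambda}$ with $Y_{j,k}=\theta_{j,k}+n^{-1/2}\epsilon_{j,k}$, the $\epsilon_{j,k}$ being i.i.d. $\mathcal N(0,1)$. $E^n_\theta$ is the corresponding expectation and $P^\pi(\cdot\mid Y^n)$ the posterior distribution. Loss: $\ell_2(\theta,\theta')=\big(\sum_{(j,k)\in\Lambda}(\theta_{j,k}-\theta'_{j,k})^2\big)^{1/2}$.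 Hölder balls: $\mathcal H(\beta,L)=\{\theta:\ |\theta_{j,k}|\le L2^{-j(\beta+1/2)}\ \text{for all }(j,k)\in\Lambda\}$, $\beta,L>0$. Block spike and slab prior: set $J_n=\lfloor\log n/\log2\rfloor$. Under $\pi$ (which depends on $n$) the vectors $\underline\theta_j=(\theta_{j,k})_{k\in I_j}$, $j\in\mathbb N$, are independent; for $j\le J_n$, $\underline\theta_j$ has law on $\mathbb R^{|I_j|}$ $$\widetilde\pi_j(dx)=(1+\nu_{j,n})^{-1}\big(\delta_0(dx)+\nu_{j,n}\,g_j(x)\,dx\big),$$ and for $j>J_n$, $\theta_{j,k}=0$. Here $g_j$ is a probability density with respect to Lebesgue measure on $\mathbb R^{|I_j|}$ with $$\sup_{x\in\mathbb R^{|I_j|}}g_j(x)\le e^{G|I_j|},\qquad \inf_{x\in[-L_0,L_0]^{|I_j|}}g_j(x)\ge e^{-G|I_j|},$$ and $\nu_{j,n}=n^{|I_j|/2}e^{-c|I_j|}$, for some constants $G>0$ and $c\ge4+G$. *)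

theory Defs
  imports "HOL-Probability.Probability"
begin

definition Lam :: "(nat \<Rightarrow> 'k set) \<Rightarrow> (nat \<times> 'k) set" where
  "Lam I = (SIGMA j:UNIV. I j)"

definition ell2 :: "'i set \<Rightarrow> ('i \<Rightarrow> real) set" where
  "ell2 \<Lambda> = {\<theta> \<in> extensional \<Lambda>. (\<lambda>i. (\<theta> i)\<^sup>2) summable_on \<Lambda>}"

definition ell2_dist :: "'i set \<Rightarrow> ('i \<Rightarrow> real) \<Rightarrow> ('i \<Rightarrow> real) \<Rightarrow> real" where
  "ell2_dist \<Lambda> \<theta> \<theta>' = sqrt (\<Sum>\<^sub>\<infinity>i\<in>\<Lambda>. (\<theta> i - \<theta>' i)\<^sup>2)"

definition obs_space :: "'i set \<Rightarrow> ('i \<Rightarrow> real) measure" where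
  "obs_space \<Lambda> = (\<Pi>\<^sub>M i\<in>\<Lambda>. borel)"

text \<open>For countable \<open>\<Lambda>\<close> the trace of the product \<open>\<sigma>\<close>-algebra on \<open>\<ell>\<^sup>2(\<Lambda>)\<close> is the Borel
  \<open>\<sigma>\<close>-algebra of the norm topology. Only the \<open>\<sigma>\<close>-algebra of this measure is used.\<close>

definition param_space :: "'i set \<Rightarrow> ('i \<Rightarrow> real) measure" where
  "param_space \<Lambda> = restrict_space (\<Pi>\<^sub>M i\<in>\<Lambda>. borel) (ell2 \<Lambda>)"

definition holder_ball :: "(nat \<Rightarrow> 'k set) \<Rightarrow> real \<Rightarrow> real \<Rightarrow> (nat \<times> 'k \<Rightarrow> real) set" where
  "holder_ball I \<beta> L = {\<theta> \<in> ell2 (Lam I).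
     \<forall>(j, k) \<in> Lam I. \<bar>\<theta> (j, k)\<bar> \<le> L * 2 powr (- real j * (\<beta> + 1/2))}"

definition white_noise :: "'i set \<Rightarrow> nat \<Rightarrow> ('i \<Rightarrow> real) \<Rightarrow> ('i \<Rightarrow> real) measure" where
  "white_noise \<Lambda> n \<theta> =
     distr (\<Pi>\<^sub>M i\<in>\<Lambda>. density lborel std_normal_density) (obs_space \<Lambda>)
       (\<lambda>\<epsilon>. \<lambda>i\<in>\<Lambda>. \<theta> i + real n powr (-1/2) * \<epsilon> i)"

definition J_max :: "nat \<Rightarrow> nat" where
  "J_max n = nat \<lfloor>ln (real n) / ln 2\<rfloor>"

definition slab_densities ::
  "(nat \<Rightarrow> 'k set) \<Rightarrow> real \<Rightarrow> real \<Rightarrow> (nat \<Rightarrow> ('k \<Rightarrow> real) \<Rightarrow> real) \<Rightarrow> bool" where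
  "slab_densities I L\<^sub>0 G g \<longleftrightarrow> (\<forall>j.
     g j \<in> borel_measurable (\<Pi>\<^sub>M k\<in>I j. lborel) \<and>
     (\<forall>x \<in> (\<Pi>\<^sub>E k\<in>I j. UNIV). 0 \<le> g j x) \<and>
     (\<integral>\<^sup>+ x. ennreal (g j x) \<partial>(\<Pi>\<^sub>M k\<in>I j. lborel)) = 1 \<and>
     (\<forall>x \<in> (\<Pi>\<^sub>E k\<in>I j. UNIV). g j x \<le> exp (G * real (card (I j)))) \<and>
     (\<forall>x \<in> (\<Pi>\<^sub>E k\<in>I j. {-L\<^sub>0..L\<^sub>0}). exp (- G * real (card (I j))) \<le> g j x))"

definition slab_weight :: "(nat \<Rightarrow> 'k set) \<Rightarrow> real \<Rightarrow> nat \<Rightarrow> nat \<Rightarrow> real" where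
  "slab_weight I c n j =
     real n powr (real (card (I j)) / 2) * exp (- c * real (card (I j)))"

definition block_law ::
  "(nat \<Rightarrow> 'k set) \<Rightarrow> (nat \<Rightarrow> ('k \<Rightarrow> real) \<Rightarrow> real) \<Rightarrow> real \<Rightarrow> nat \<Rightarrow> nat \<Rightarrow> ('k \<Rightarrow> real) measure" where
  "block_law I g c n j =
     measure_of (\<Pi>\<^sub>E k\<in>I j. UNIV) (sets (\<Pi>\<^sub>M k\<in>I j. borel))
       (\<lambda>A. ennreal (1 / (1 + slab_weight I c n j)) *
          (indicator A (\<lambda>k\<in>I j. 0)
            + ennreal (slab_weight I c n j) *
              (\<integral>\<^sup>+ x\<in>A. ennreal (g j x) \<partial>(\<Pi>\<^sub>M k\<in>I j. lborel))))"

definition block_prior ::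
  "(nat \<Rightarrow> 'k set) \<Rightarrow> (nat \<Rightarrow> ('k \<Rightarrow> real) \<Rightarrow> real) \<Rightarrow> real \<Rightarrow> nat \<Rightarrow> (nat \<times> 'k \<Rightarrow> real) measure" where
  "block_prior I g c n =
     distr (\<Pi>\<^sub>M j\<in>{..J_max n}. block_law I g c n j) (param_space (Lam I))
       (\<lambda>x. \<lambda>(j, k)\<in>Lam I. if j \<le> J_max n then x j k else 0)"

text \<open>\<open>\<kappa>\<close> is a version of the posterior (a regular conditional distribution of the parameter given
  the observation) for prior \<open>\<pi>\<close> and sampling model \<open>P\<close>: both sides of the equation are
  \<open>Pr(\<theta> \<in> A, Y \<in> B)\<close> under the joint law \<open>\<pi>(d\<theta>) P\<^sub>\<theta>(dy)\<close>.\<close>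

definition is_posterior ::
  "'a measure \<Rightarrow> 'b measure \<Rightarrow> ('a \<Rightarrow> 'b measure) \<Rightarrow> ('b \<Rightarrow> 'a measure) \<Rightarrow> bool" where
  "is_posterior \<pi> \<Y> P \<kappa> \<longleftrightarrow>
     \<kappa> \<in> measurable \<Y> (prob_algebra \<pi>) \<and>
     (\<forall>A \<in> sets \<pi>. \<forall>B \<in> sets \<Y>.
        (\<integral>\<^sup>+ \<theta>\<in>A. emeasure (P \<theta>) B \<partial>\<pi>) =
        (\<integral>\<^sup>+ \<theta>. (\<integral>\<^sup>+ y\<in>B. emeasure (\<kappa> y) A \<partial>P \<theta>) \<partial>\<pi>))"

end

theory Submission
  imports Defs
begin

text \<open>The posterior mass of a far-away set is controlled through a fractional power of an
exponential moment. Write \<open>N = n powr (1 / (2 * \<beta> + 1))\<close>, which is \<open>n\<close>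
times the squared rate. If every point of \<open>A\<close> that the prior charges satisfies \<open>x
\<le> n * \<Sum>(\<theta>\<^sub>i - \<theta>\<^sub>0\<^sub>i)\<^sup>2\<close>, the sum being over the
levels \<open>j \<le> J_max n\<close>, then by Markov's inequality the posterior mass of
\<open>A\<close> is at most \<open>exp (- x / 16)\<close> times the posterior mean of \<open>exp (n / 16
* \<Sum>(\<theta>\<^sub>i - \<theta>\<^sub>0\<^sub>i)\<^sup>2)\<close>. Prior and likelihood are
products over the levels, so this mean is a product of one ratio per block.

The one-block ratio is bounded pointwise in the data by \<open>V\<^sup>4\<close> (lemma
\<open>block_ratio_bound\<close>), where \<open>V\<close> depends on the data only through the noise
\<open>\<epsilon>\<close> of the block. On rough levels, \<open>2 ^ j \<le> N\<close>, the slab carries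
enough mass near the truth, and \<open>V = exp (O(d)) * exp (9 / 32 * |\<epsilon>|\<^sup>2)\<close> in
dimension \<open>d\<close>. On finer levels the spike dominates thanks to the small weight \<open>exp (-
c * d)\<close>, and \<open>V = exp (n * |\<theta>\<^sub>0\<^sub>j|\<^sup>2 / 4) * (1 + (3 / 5) ^ d * exp
(9 / 32 * |\<epsilon>|\<^sup>2))\<close>.

The bound \<open>V\<^sup>4\<close> itself has no expectation under Gaussian noise, since it contains
\<open>exp (9 / 8 * |\<epsilon>|\<^sup>2)\<close>. But a probability that is at most \<open>w ^
4\<close> is also at most \<open>w\<close>, so the fourth root can be taken: the posterior mass is at
most \<open>exp (- x / 64)\<close> times the product of the \<open>V\<close>, and each \<open>V\<close>
has a finite mean. The bound holds on the whole sample space and for every sample size. The blocks of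
noise are independent, and summing the logarithms of the means over the levels gives
\<open>O(N)\<close>: rough levels contribute their total dimension, fine levels the energy of the truth
beyond frequency \<open>N\<close>, which the Hoelder condition bounds, and a convergent series. Since
the levels above \<open>J_max n\<close> carry an energy \<open>O(N / n)\<close>, a large enough radius
makes \<open>x / 64\<close> exceed this by \<open>N\<close>.

A posterior is a conditional distribution and is thus determined only up to null sets of the marginal
law of the data, whereas the claim is about the law at a fixed \<open>\<theta>\<^sub>0\<close>, which
may have infinitely many nonzero coordinates. The two are linked by the pure noise law: Bayes' formula is
proved almost surely under it, and the law at any square summable \<open>\<theta>\<^sub>0\<close> is
absolutely continuous with respect to it (the qualitative half of the Cameron--Martin theorem).\<close>

section \<open>Gaussian integrals\<close>

lemma nn_integral_gaussian:
  fixes a m :: real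
  assumes "0 < a"
  shows "(\<integral>\<^sup>+x. ennreal (exp (- (a * (x - m)\<^sup>2))) \<partial>lborel) = ennreal (sqrt (pi / a))"
proof -
  define s where "s = sqrt (1 / (2 * a))"
  have s: "s > 0" "s\<^sup>2 = 1 / (2 * a)" using assms by (auto simp: s_def)
  have "(\<integral>\<^sup>+x. ennreal (exp (- (a * (x - m)\<^sup>2))) \<partial>lborel)
      = (\<integral>\<^sup>+x. ennreal (sqrt (pi / a)) * ennreal (normal_density m s x) \<partial>lborel)"
    using assms by (intro nn_integral_cong)
      (auto simp: normal_density_def s ennreal_mult[symmetric] field_simps real_sqrt_divide)
  also have "\<dots> = ennreal (sqrt (pi / a)) * (\<integral>\<^sup>+x. ennreal (normal_density m s x) \<partial>lborel)"
    by (rule nn_integral_cmult) auto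
  also have "(\<integral>\<^sup>+x. ennreal (normal_density m s x) \<partial>lborel) = 1"
    using s by (subst nn_integral_eq_integral) auto
  finally show ?thesis by simp
qed

text \<open>The likelihood ratio of \<open>N(x, 1 / n)\<close> against \<open>N(0, 1 / n)\<close> at the
  observation \<open>y\<close>.\<close>

definition lik :: "real \<Rightarrow> real \<Rightarrow> real \<Rightarrow> real" where
  "lik n y x = exp (n * y * x - n * x\<^sup>2 / 2)"

lemma lik_pos[simp]: "0 < lik n y x" "0 \<le> lik n y x" "lik n y 0 = 1"
  by (auto simp: lik_def)

lemma lik_measurable[measurable]: "(\<lambda>p. lik n (f p) (h p)) \<in> borel_measurable M"
  if [measurable]: "f \<in> borel_measurable M" "h \<in> borel_measurable M"
  unfolding lik_def by measurable

text \<open>The tilt \<open>exp (n * (x - \<theta>)\<^sup>2 / 16)\<close> costs only a constant factor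
  in the Gaussian integral, because \<open>(x - \<theta>)\<^sup>2 \<le> 2 * (x - y)\<^sup>2 + 2 * (y -
  \<theta>)\<^sup>2\<close> leaves the exponent \<open>- 3 / 8 * n * (x - y)\<^sup>2\<close>.\<close>

lemma tilted_lik_integral_le:
  fixes n y \<theta> :: real
  assumes "0 < n"
  shows "(\<integral>\<^sup>+x. ennreal (exp (n * (x - \<theta>)\<^sup>2 / 16) * lik n y x) \<partial>lborel)
    \<le> ennreal (sqrt (8 * pi / 3) / sqrt n * exp (n * (y - \<theta>)\<^sup>2 / 8 + n * y\<^sup>2 / 2))"
proof -
  let ?c = "exp (n * (y - \<theta>)\<^sup>2 / 8 + n * y\<^sup>2 / 2)"
  have "(\<integral>\<^sup>+x. ennreal (exp (n * (x - \<theta>)\<^sup>2 / 16) * lik n y x) \<partial>lborel)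
    \<le> (\<integral>\<^sup>+x. ennreal ?c * ennreal (exp (- ((3 / 8 * n) * (x - y)\<^sup>2))) \<partial>lborel)"
  proof (intro nn_integral_mono)
    fix x :: real
    have "0 \<le> n * ((x - y) - (y - \<theta>))\<^sup>2" using assms by simp
    then have "n * (x - \<theta>)\<^sup>2 / 16 + (n * y * x - n * x\<^sup>2 / 2)
      \<le> (n * (y - \<theta>)\<^sup>2 / 8 + n * y\<^sup>2 / 2) - (3 / 8 * n) * (x - y)\<^sup>2"
      by (simp add: power2_eq_square field_simps)
    then show "ennreal (exp (n * (x - \<theta>)\<^sup>2 / 16) * lik n y x)
      \<le> ennreal ?c * ennreal (exp (- ((3 / 8 * n) * (x - y)\<^sup>2)))"
      by (subst ennreal_mult[symmetric]) (auto simp: lik_def exp_add[symmetric])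
  qed
  also have "\<dots> = ennreal ?c * ennreal (sqrt (pi / (3 / 8 * n)))"
    using assms by (subst nn_integral_cmult, simp, subst nn_integral_gaussian) auto
  also have "\<dots> = ennreal (sqrt (8 * pi / 3) / sqrt n * ?c)"
  proof -
    have "sqrt (pi / (3 / 8 * n)) = sqrt (8 * pi / 3) / sqrt n"
      by (subst real_sqrt_divide[symmetric]) (simp add: field_simps)
    then show ?thesis using assms by (subst ennreal_mult[symmetric]) (auto simp: mult.commute)
  qed
  finally show ?thesis .
qed

text \<open>It suffices to integrate over the interval of half-width \<open>1 / sqrt n \<le> 1\<close>
  around \<open>\<theta>\<close>, which the margin of one between \<open>\<bar>\<theta>\<bar>\<close>
  and \<open>L\<close> keeps inside the box.\<close>

lemma lik_integral_ge:
  fixes n y \<theta> L :: real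
  assumes "1 \<le> n" and "\<bar>\<theta>\<bar> \<le> L - 1"
  shows "ennreal (2 / (exp 1 * sqrt n) * exp (n * y\<^sup>2 / 2 - n * (y - \<theta>)\<^sup>2))
    \<le> (\<integral>\<^sup>+x. ennreal (lik n y x) * indicator {-L..L} x \<partial>lborel)"
proof -
  let ?h = "1 / sqrt n"
  have h: "0 < ?h" "?h \<le> 1" "n * ?h\<^sup>2 = 1"
    using assms by (auto simp: power_divide)
  let ?c = "exp (n * y\<^sup>2 / 2 - n * (y - \<theta>)\<^sup>2 - 1)"
  have "ennreal (2 / (exp 1 * sqrt n) * exp (n * y\<^sup>2 / 2 - n * (y - \<theta>)\<^sup>2))
      = ennreal ?c * emeasure lborel {\<theta> - ?h..\<theta> + ?h}"
    using h by (simp add: ennreal_mult[symmetric] exp_diff mult_ac)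
  also have "\<dots> = (\<integral>\<^sup>+x. ennreal ?c * indicator {\<theta> - ?h..\<theta> + ?h} x \<partial>lborel)"
    by (rule nn_integral_cmult_indicator[symmetric]) auto
  also have "\<dots> \<le> (\<integral>\<^sup>+x. ennreal (lik n y x) * indicator {-L..L} x \<partial>lborel)"
  proof (intro nn_integral_mono)
    fix x :: real
    show "ennreal ?c * indicator {\<theta> - ?h..\<theta> + ?h} x \<le> ennreal (lik n y x) * indicator {-L..L} x"
    proof (cases "x \<in> {\<theta> - ?h..\<theta> + ?h}")
      case True
      then have "\<bar>x - \<theta>\<bar> \<le> ?h" by auto
      then have "(x - \<theta>)\<^sup>2 \<le> ?h\<^sup>2" by (rule abs_le_square_iff[THEN iffD1, of _ ?h, simplified abs_of_pos[OF h(1)]])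
      then have "n * (x - \<theta>)\<^sup>2 \<le> 1" using h(3) assms by (metis mult_left_mono order_trans zero_le_one)
      moreover have "0 \<le> n * ((y - \<theta>) + (x - \<theta>))\<^sup>2" using assms by simp
      ultimately have "n * y\<^sup>2 / 2 - n * (y - \<theta>)\<^sup>2 - 1 \<le> n * y * x - n * x\<^sup>2 / 2"
        by (simp add: power2_eq_square field_simps)
      moreover have "x \<in> {-L..L}"
        using \<open>\<bar>x - \<theta>\<bar> \<le> ?h\<close> h(2) assms(2) unfolding atLeastAtMost_iff by linarith
      ultimately show ?thesis using True by (simp add: lik_def ennreal_leI)
    qed auto
  qed
  finally show ?thesis .
qed

abbreviation "std_normal \<equiv> density lborel (\<lambda>x. ennreal (std_normal_density x))"

lemma std_normal_exp_square:
  "(\<integral>\<^sup>+z. ennreal (exp (9 / 32 * z\<^sup>2)) \<partial>std_normal) = ennreal (4 / sqrt 7)"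
proof -
  have "(\<integral>\<^sup>+z. ennreal (exp (9 / 32 * z\<^sup>2)) \<partial>std_normal)
      = (\<integral>\<^sup>+z. ennreal (1 / sqrt (2 * pi)) * ennreal (exp (- (7 / 32 * (z - 0)\<^sup>2))) \<partial>lborel)"
    by (subst nn_integral_density)
      (auto simp: std_normal_density_def ennreal_mult[symmetric] exp_add[symmetric] intro!: nn_integral_cong)
  also have "\<dots> = ennreal (1 / sqrt (2 * pi)) * ennreal (sqrt (pi / (7 / 32)))"
    by (subst nn_integral_cmult, simp, subst nn_integral_gaussian) auto
  also have "\<dots> = ennreal (4 / sqrt 7)"
  proof -
    have "1 / sqrt (2 * pi) * sqrt (pi / (7 / 32)) = sqrt (16 / 7)"
      by (simp add: real_sqrt_divide[symmetric] real_sqrt_mult[symmetric] del: real_sqrt_divide real_sqrt_mult)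
    also have "\<dots> = 4 / sqrt 7" by (simp add: real_sqrt_divide)
    finally show ?thesis by (subst ennreal_mult[symmetric]) auto
  qed
  finally show ?thesis .
qed

text \<open>The one-dimensional Cameron--Martin formula.\<close>

lemma std_normal_shift:
  fixes h :: "real \<Rightarrow> ennreal"
  assumes [measurable]: "h \<in> borel_measurable borel"
  shows "(\<integral>\<^sup>+z. h z * ennreal (exp (t * z - t\<^sup>2 / 2)) \<partial>std_normal) = (\<integral>\<^sup>+z. h (t + z) \<partial>std_normal)"
proof -
  have "(\<integral>\<^sup>+z. h z * ennreal (exp (t * z - t\<^sup>2 / 2)) \<partial>std_normal)
      = (\<integral>\<^sup>+z. h z * ennreal (std_normal_density (z - t)) \<partial>lborel)"
  proof (subst nn_integral_density, simp, simp, intro nn_integral_cong)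
    fix z :: real
    have "std_normal_density z * exp (t * z - t\<^sup>2 / 2) = std_normal_density (z - t)"
      by (simp add: std_normal_density_def exp_add[symmetric] power2_eq_square field_simps)
    then show "ennreal (std_normal_density z) * (h z * ennreal (exp (t * z - t\<^sup>2 / 2)))
        = h z * ennreal (std_normal_density (z - t))"
      by (metis (no_types, lifting) ennreal_mult exp_ge_zero mult.left_commute normal_density_nonneg)
  qed
  also have "\<dots> = (\<integral>\<^sup>+z. h (t + z) * ennreal (std_normal_density z) \<partial>lborel)"
    by (subst nn_integral_real_affine[where c=1 and t=t]) auto
  also have "\<dots> = (\<integral>\<^sup>+z. h (t + z) \<partial>std_normal)"
    by (subst nn_integral_density) (auto simp: mult.commute)
  finally show ?thesis .
qed

section \<open>The posterior on one block\<close>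

lemma slab_numerator_le:
  fixes g :: "('k \<Rightarrow> real) \<Rightarrow> real"
  assumes fin: "finite I" and n: "0 < n"
    and g_le: "\<And>x. x \<in> (\<Pi>\<^sub>E k\<in>I. UNIV) \<Longrightarrow> g x \<le> exp (G * real (card I))"
  shows "(\<integral>\<^sup>+x. ennreal (g x) * ennreal (\<Prod>k\<in>I. exp (n * (x k - \<theta> k)\<^sup>2 / 16) * lik n (y k) (x k)) \<partial>(\<Pi>\<^sub>M k\<in>I. lborel))
    \<le> ennreal (exp (G * real (card I)) * (sqrt (8 * pi / 3) / sqrt n) ^ card I *
        exp ((\<Sum>k\<in>I. n * (y k - \<theta> k)\<^sup>2) / 8 + (\<Sum>k\<in>I. n * (y k)\<^sup>2) / 2))"
proof -
  interpret product_sigma_finite "\<lambda>_::'k. lborel :: real measure" by standard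
  let ?f = "\<lambda>k x. exp (n * (x - \<theta> k)\<^sup>2 / 16) * lik n (y k) x"
  let ?b = "\<lambda>k. exp (n * (y k - \<theta> k)\<^sup>2 / 8 + n * (y k)\<^sup>2 / 2)"
  have "(\<integral>\<^sup>+x. ennreal (g x) * ennreal (\<Prod>k\<in>I. ?f k (x k)) \<partial>(\<Pi>\<^sub>M k\<in>I. lborel))
    \<le> (\<integral>\<^sup>+x. ennreal (exp (G * real (card I))) * (\<Prod>k\<in>I. ennreal (?f k (x k))) \<partial>(\<Pi>\<^sub>M k\<in>I. lborel))"
    by (intro nn_integral_mono) (auto simp: space_PiM prod_ennreal intro!: mult_mono g_le ennreal_leI)
  also have "\<dots> = ennreal (exp (G * real (card I))) * (\<Prod>k\<in>I. \<integral>\<^sup>+x. ennreal (?f k x) \<partial>lborel)"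
    using product_nn_integral_prod[OF fin, of "\<lambda>k x. ennreal (?f k x)"]
    by (subst nn_integral_cmult) auto
  also have "\<dots> \<le> ennreal (exp (G * real (card I))) * (\<Prod>k\<in>I. ennreal (sqrt (8 * pi / 3) / sqrt n * ?b k))"
    using n by (intro mult_left_mono prod_mono_ennreal tilted_lik_integral_le) auto
  also have "\<dots> = ennreal (exp (G * real (card I)) * (\<Prod>k\<in>I. sqrt (8 * pi / 3) / sqrt n * ?b k))"
  proof -
    have "(\<Prod>k\<in>I. ennreal (sqrt (8 * pi / 3) / sqrt n * ?b k)) = ennreal (\<Prod>k\<in>I. sqrt (8 * pi / 3) / sqrt n * ?b k)"
      using n by (intro prod_ennreal) simp
    then show ?thesis by (simp only:) (rule ennreal_mult'[symmetric], simp)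
  qed
  also have "(\<Prod>k\<in>I. sqrt (8 * pi / 3) / sqrt n * ?b k) = (sqrt (8 * pi / 3) / sqrt n) ^ card I *
        exp ((\<Sum>k\<in>I. n * (y k - \<theta> k)\<^sup>2) / 8 + (\<Sum>k\<in>I. n * (y k)\<^sup>2) / 2)"
    by (subst prod.distrib) (simp add: exp_sum[OF fin, symmetric] sum.distrib sum_divide_distrib)
  finally show ?thesis by (simp add: mult.assoc)
qed

lemma slab_denominator_ge:
  fixes g :: "('k \<Rightarrow> real) \<Rightarrow> real"
  assumes fin: "finite I" and n: "1 \<le> n"
    and [measurable]: "g \<in> borel_measurable (\<Pi>\<^sub>M k\<in>I. lborel)"
    and g_ge: "\<And>x. x \<in> (\<Pi>\<^sub>E k\<in>I. {-L..L}) \<Longrightarrow> exp (- G * real (card I)) \<le> g x"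
    and \<theta>: "\<And>k. k \<in> I \<Longrightarrow> \<bar>\<theta> k\<bar> \<le> L - 1"
  shows "ennreal (exp (- G * real (card I)) * (2 / (exp 1 * sqrt n)) ^ card I *
        exp ((\<Sum>k\<in>I. n * (y k)\<^sup>2) / 2 - (\<Sum>k\<in>I. n * (y k - \<theta> k)\<^sup>2)))
    \<le> (\<integral>\<^sup>+x. ennreal (g x) * ennreal (\<Prod>k\<in>I. lik n (y k) (x k)) \<partial>(\<Pi>\<^sub>M k\<in>I. lborel))"
proof -
  interpret product_sigma_finite "\<lambda>_::'k. lborel :: real measure" by standard
  let ?b = "\<lambda>k. exp (n * (y k)\<^sup>2 / 2 - n * (y k - \<theta> k)\<^sup>2)"
  have eq: "exp (- G * real (card I)) * (2 / (exp 1 * sqrt n)) ^ card I *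
        exp ((\<Sum>k\<in>I. n * (y k)\<^sup>2) / 2 - (\<Sum>k\<in>I. n * (y k - \<theta> k)\<^sup>2))
      = exp (- G * real (card I)) * (\<Prod>k\<in>I. 2 / (exp 1 * sqrt n) * ?b k)"
    by (subst prod.distrib) (simp add: exp_sum[OF fin, symmetric] sum_subtractf sum_divide_distrib)
  have "ennreal (exp (- G * real (card I)) * (2 / (exp 1 * sqrt n)) ^ card I *
        exp ((\<Sum>k\<in>I. n * (y k)\<^sup>2) / 2 - (\<Sum>k\<in>I. n * (y k - \<theta> k)\<^sup>2))) = ennreal (exp (- G * real (card I))) * (\<Prod>k\<in>I. ennreal (2 / (exp 1 * sqrt n) * ?b k))"
  proof -
    have "(\<Prod>k\<in>I. ennreal (2 / (exp 1 * sqrt n) * ?b k)) = ennreal (\<Prod>k\<in>I. 2 / (exp 1 * sqrt n) * ?b k)"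
      using n by (intro prod_ennreal) simp
    then show ?thesis unfolding eq by (simp only:) (rule ennreal_mult', simp)
  qed
  also have "\<dots> \<le> ennreal (exp (- G * real (card I))) *
      (\<Prod>k\<in>I. \<integral>\<^sup>+x. ennreal (lik n (y k) x) * indicator {-L..L} x \<partial>lborel)"
    using n \<theta> by (intro mult_left_mono prod_mono_ennreal lik_integral_ge) auto
  also have "\<dots> = (\<integral>\<^sup>+x. ennreal (exp (- G * real (card I))) *
      (\<Prod>k\<in>I. ennreal (lik n (y k) (x k)) * indicator {-L..L} (x k)) \<partial>(\<Pi>\<^sub>M k\<in>I. lborel))"
    using product_nn_integral_prod[OF fin, of "\<lambda>k x. ennreal (lik n (y k) x) * indicator {-L..L} x"]
    by (subst nn_integral_cmult) auto
  also have "\<dots> \<le> (\<integral>\<^sup>+x. ennreal (g x) * ennreal (\<Prod>k\<in>I. lik n (y k) (x k)) \<partial>(\<Pi>\<^sub>M k\<in>I. lborel))"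
  proof (intro nn_integral_mono)
    fix x :: "'k \<Rightarrow> real" assume x: "x \<in> space (\<Pi>\<^sub>M k\<in>I. lborel)"
    show "ennreal (exp (- G * real (card I))) *
      (\<Prod>k\<in>I. ennreal (lik n (y k) (x k)) * indicator {-L..L} (x k))
      \<le> ennreal (g x) * ennreal (\<Prod>k\<in>I. lik n (y k) (x k))"
    proof (cases "\<forall>k\<in>I. x k \<in> {-L..L}")
      case True
      then have "x \<in> (\<Pi>\<^sub>E k\<in>I. {-L..L})" using x by (auto simp: space_PiM PiE_iff)
      then have "exp (- G * real (card I)) \<le> g x" by (rule g_ge)
      moreover have "(\<Prod>k\<in>I. ennreal (lik n (y k) (x k)) * indicator {-L..L} (x k))
          = ennreal (\<Prod>k\<in>I. lik n (y k) (x k))"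
        using True by (subst prod_ennreal[symmetric]) (auto intro!: prod.cong simp: indicator_def)
      ultimately show ?thesis by (simp only: mult_right_mono ennreal_leI zero_le)
    next
      case False
      then have "(\<Prod>k\<in>I. ennreal (lik n (y k) (x k)) * indicator {-L..L} (x k)) = 0"
        using fin False by (intro prod_zero) (auto simp: indicator_def)
      then show ?thesis by (simp only: mult_zero_right zero_le)
    qed
  qed
  finally show ?thesis .
qed

lemma sqrt_8pi3_le: "sqrt (8 * pi / 3) \<le> 33/10"
proof -
  have "8 * pi / 3 \<le> (33/10)\<^sup>2" using pi_less_4 by (simp add: power2_eq_square)
  then show ?thesis by (rule real_le_lsqrt[rotated 1]) auto
qed

text \<open>The numerical fact behind the condition \<open>4 + G \<le> c\<close>: relative to the spike,
  the slab loses \<open>exp (G - c)\<close> per coordinate and gains at most \<open>sqrt (8 * pi /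
  3)\<close>. The constant \<open>3 / 5\<close> leaves room for the factor \<open>4 / sqrt 7\<close>
  that the mean of \<open>exp (9 / 32 * \<epsilon>\<^sup>2)\<close> contributes later.\<close>

lemma spike_advantage: "exp (-4) * sqrt (8 * pi / 3) \<le> (3/5 :: real) ^ 4"
proof -
  have "(5/2::real) \<le> exp 1" using exp_lower_Taylor_quadratic[of 1] by simp
  then have "(5/2::real)^4 \<le> exp 1 ^ 4" by (rule power_mono) simp
  also have "\<dots> = exp 4" by (simp add: exp_of_nat_mult[symmetric])
  finally have "exp (-4::real) \<le> 1 / (5/2)^4" by (simp add: exp_minus field_simps)
  then have "exp (-4) * sqrt (8 * pi / 3) \<le> (1 / (5/2)^4) * (33/10)"
    using sqrt_8pi3_le by (intro mult_mono) auto
  also have "\<dots> \<le> (3/5 :: real) ^ 4" by (simp add: eval_nat_numeral)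
  finally show ?thesis .
qed

text \<open>Fourth roots of bounds for the tilted posterior ratio of a block of dimension
  \<open>d\<close>; \<open>Z\<close> is the squared norm of the standardised noise and \<open>T\<close>
  is \<open>n\<close> times the energy of the truth in the block.\<close>

definition block_bound_rough :: "real \<Rightarrow> nat \<Rightarrow> real \<Rightarrow> real" where
  "block_bound_rough K d Z = exp K ^ d * exp (9 / 32 * Z)"

definition block_bound_smooth :: "real \<Rightarrow> nat \<Rightarrow> real \<Rightarrow> real" where
  "block_bound_smooth T d Z = exp (T / 4) * (1 + (3/5) ^ d * exp (9 / 32 * Z))"

lemma sum_signal_le:
  assumes "0 \<le> n"
  shows "(\<Sum>k\<in>I. n * (\<theta> k :: real)\<^sup>2) \<le> 2 * (\<Sum>k\<in>I. n * (y k)\<^sup>2) + 2 * (\<Sum>k\<in>I. n * (y k - \<theta> k)\<^sup>2)"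
    and "(\<Sum>k\<in>I. n * (y k)\<^sup>2) \<le> 2 * (\<Sum>k\<in>I. n * (\<theta> k)\<^sup>2) + 2 * (\<Sum>k\<in>I. n * (y k - \<theta> k)\<^sup>2)"
proof -
  have "n * (\<theta> k)\<^sup>2 \<le> 2 * (n * (y k)\<^sup>2) + 2 * (n * (y k - \<theta> k)\<^sup>2)" for k
  proof -
    have "0 \<le> n * (y k + (y k - \<theta> k))\<^sup>2" using assms by simp
    then show ?thesis by (simp add: power2_eq_square algebra_simps)
  qed
  then show "(\<Sum>k\<in>I. n * (\<theta> k :: real)\<^sup>2) \<le> 2 * (\<Sum>k\<in>I. n * (y k)\<^sup>2) + 2 * (\<Sum>k\<in>I. n * (y k - \<theta> k)\<^sup>2)"
    by (simp add: sum_distrib_left sum.distrib[symmetric] sum_mono)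
  have "n * (y k)\<^sup>2 \<le> 2 * (n * (\<theta> k)\<^sup>2) + 2 * (n * (y k - \<theta> k)\<^sup>2)" for k
  proof -
    have "0 \<le> n * (\<theta> k - (y k - \<theta> k))\<^sup>2" using assms by simp
    then show ?thesis by (simp add: power2_eq_square algebra_simps)
  qed
  then show "(\<Sum>k\<in>I. n * (y k)\<^sup>2) \<le> 2 * (\<Sum>k\<in>I. n * (\<theta> k)\<^sup>2) + 2 * (\<Sum>k\<in>I. n * (y k - \<theta> k)\<^sup>2)"
    by (simp add: sum_distrib_left sum.distrib[symmetric] sum_mono)
qed

text \<open>Both sides carry the same normalisation \<open>1 / (1 + \<nu>)\<close> and are unnormalised
  integrals against the block prior. The right-hand side is bounded below by its slab part to obtain the
  rough bound, and by its spike part to obtain the smooth one. The quantities \<open>Z\<close>,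
  \<open>T\<close> and \<open>Y\<close> are comparable by the inequality \<open>(a + b)\<^sup>2 \<le> 2
  * a\<^sup>2 + 2 * b\<^sup>2\<close>.\<close>

lemma block_ratio_bound:
  fixes g :: "('k \<Rightarrow> real) \<Rightarrow> real" and n c G L V :: real and I :: "'k set" and \<theta> y :: "'k \<Rightarrow> real"
  defines "d \<equiv> card I"
  defines "\<nu> \<equiv> n powr (real d / 2) * exp (- c * real d)"
  defines "Z \<equiv> \<lambda>y. \<Sum>k\<in>I. n * (y k - \<theta> k)\<^sup>2" and "T \<equiv> \<Sum>k\<in>I. n * (\<theta> k)\<^sup>2"
  assumes fin: "finite I" and ne: "I \<noteq> {}" and n: "1 \<le> n" and cG: "4 + G \<le> c" and G: "0 < G"
    and [measurable]: "g \<in> borel_measurable (\<Pi>\<^sub>M k\<in>I. lborel)"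
    and g_le: "\<And>x. x \<in> (\<Pi>\<^sub>E k\<in>I. UNIV) \<Longrightarrow> g x \<le> exp (G * real d)"
    and g_ge: "\<And>x. x \<in> (\<Pi>\<^sub>E k\<in>I. {-L..L}) \<Longrightarrow> exp (- G * real d) \<le> g x"
    and \<theta>: "\<And>k. k \<in> I \<Longrightarrow> \<bar>\<theta> k\<bar> \<le> L - 1"
    and V: "V = block_bound_rough (c + G) d (Z y) \<or> V = block_bound_smooth T d (Z y)"
  shows "ennreal (\<Prod>k\<in>I. exp (n * (\<theta> k)\<^sup>2 / 16)) +
      ennreal \<nu> * (\<integral>\<^sup>+x. ennreal (g x) * ennreal (\<Prod>k\<in>I. exp (n * (x k - \<theta> k)\<^sup>2 / 16) * lik n (y k) (x k)) \<partial>(\<Pi>\<^sub>M k\<in>I. lborel))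
    \<le> ennreal (V ^ 4) *
      (1 + ennreal \<nu> * (\<integral>\<^sup>+x. ennreal (g x) * ennreal (\<Prod>k\<in>I. lik n (y k) (x k)) \<partial>(\<Pi>\<^sub>M k\<in>I. lborel)))"
    (is "?spike + ennreal \<nu> * ?num \<le> _ * (1 + ennreal \<nu> * ?den)")
proof -
  define Y where "Y = (\<Sum>k\<in>I. n * (y k)\<^sup>2) / 2"
  let ?Z = "Z y" and ?s = "sqrt (8 * pi / 3)"
  have TZY: "0 \<le> T" "0 \<le> ?Z" "0 \<le> Y" using n by (auto simp: T_def Z_def Y_def intro!: sum_nonneg divide_nonneg_nonneg)
  have T_le: "T \<le> 4 * Y + 2 * ?Z" and Y_le: "Y \<le> T + ?Z"
    using sum_signal_le(1)[of n \<theta> I y] sum_signal_le(2)[of n y I \<theta>] n by (simp_all add: T_def Z_def Y_def)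
  have d: "1 \<le> d" using fin ne by (simp add: d_def Suc_leI card_gt_0_iff)
  have \<nu>: "0 \<le> \<nu>" by (simp add: \<nu>_def)
  \<comment> \<open>The weight contains the factor \<open>sqrt n ^ d\<close>, which cancels the width \<open>1 / sqrt n\<close> of the likelihood in
    each coordinate.\<close>
  have \<nu>_eq: "\<nu> = sqrt n ^ d * exp (- c) ^ d"
  proof -
    have "n powr (real d / 2) = (n powr (1/2)) powr real d" by (simp add: powr_powr)
    also have "\<dots> = sqrt n ^ d" using n by (simp add: powr_half_sqrt powr_realpow)
    finally show ?thesis by (simp add: \<nu>_def exp_of_nat_mult[symmetric] mult.commute)
  qed
  have eG: "exp (G * real d) = exp G ^ d" "exp (- G * real d) = exp (- G) ^ d"
    by (simp_all add: exp_of_nat_mult[symmetric] mult.commute)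
  have spike_le: "?spike = ennreal (exp (T / 16))"
    using fin by (simp add: exp_sum[symmetric] T_def sum_divide_distrib)
  have "ennreal \<nu> * ?num \<le> ennreal \<nu> * ennreal (exp (G * real d) * (?s / sqrt n) ^ d * exp (?Z / 8 + Y))"
    using slab_numerator_le[OF fin, of n g G \<theta> y] n g_le
    by (intro mult_left_mono) (auto simp: d_def Y_def Z_def)
  also have "\<dots> = ennreal ((exp (G - c) * ?s) ^ d * exp (?Z / 8 + Y))"
  proof -
    have "\<nu> * (exp (G * real d) * (?s / sqrt n) ^ d * exp (?Z / 8 + Y)) = (exp (G - c) * ?s) ^ d * exp (?Z / 8 + Y)"
    proof -
      have "exp (G - c) * ?s = sqrt n * exp (- c) * exp G * (?s / sqrt n)"
        using n by (simp add: exp_diff exp_minus field_simps)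
      then show ?thesis unfolding \<nu>_eq eG by (simp only: power_mult_distrib mult_ac)
    qed
    then show ?thesis using \<nu> n by (subst ennreal_mult[symmetric]) auto
  qed
  also have "\<dots> \<le> ennreal (((3/5) ^ 4) ^ d * exp (?Z / 8 + Y))"
  proof -
    have "exp (G - c) * ?s \<le> exp (-4) * ?s" using cG by (intro mult_right_mono) auto
    also have "\<dots> \<le> (3/5) ^ 4" by (rule spike_advantage)
    finally show ?thesis by (intro ennreal_leI mult_right_mono power_mono) auto
  qed
  finally have num_le: "?spike + ennreal \<nu> * ?num \<le> ennreal (exp (T / 16) + ((3/5) ^ 4) ^ d * exp (?Z / 8 + Y))"
    unfolding spike_le by (subst ennreal_plus) (auto intro: add_left_mono)
  show ?thesis
  proof (rule disjE[OF V])
    assume V: "V = block_bound_rough (c + G) d (Z y)"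
    let ?l = "exp (- G * real d) * (2 / (exp 1 * sqrt n)) ^ d * exp (Y - ?Z)"
    have "((3/5) ^ 4) ^ d \<le> (1::real)" by (intro power_le_one) auto
    then have "((3/5) ^ 4) ^ d * exp (?Z / 8 + Y) \<le> 1 * exp (?Z / 8 + Y)" by (rule mult_right_mono) simp
    moreover have "exp (T / 16) \<le> exp (?Z / 8 + Y)" using T_le TZY by simp
    ultimately have "exp (T / 16) + ((3/5) ^ 4) ^ d * exp (?Z / 8 + Y) \<le> 2 ^ 1 * exp (?Z / 8 + Y)"
      unfolding power_one_right by linarith
    also have "\<dots> \<le> 2 ^ d * exp (?Z / 8 + Y)" using d by (intro mult_right_mono power_increasing) auto
    also have "\<dots> \<le> (exp (4 * (c + G)) * exp (- c) * exp (- G) * (2 / exp 1)) ^ d * exp (?Z / 8 + Y)"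
    proof (intro mult_right_mono power_mono)
      have "2 * 1 \<le> 2 * exp (4 * (c + G) + - c + - G + - 1)" using cG G by (intro mult_left_mono) auto
      also have "\<dots> = exp (4 * (c + G)) * exp (- c) * exp (- G) * (2 / exp 1)"
        by (simp only: exp_add exp_minus) (simp add: field_simps)
      finally show "2 \<le> exp (4 * (c + G)) * exp (- c) * exp (- G) * (2 / exp 1)" by simp
    qed auto
    also have "\<dots> = (exp (4 * (c + G))) ^ d * exp (9 / 8 * ?Z) * (\<nu> * ?l)"
    proof -
      have "exp (9 / 8 * ?Z) * exp (Y - ?Z) = exp (?Z / 8 + Y)" by (simp add: exp_add[symmetric])
      moreover have "\<nu> * (2 / (exp 1 * sqrt n)) ^ d = (exp (- c) * (2 / exp 1)) ^ d"
      proof -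
        have "sqrt n * exp (- c) * (2 / (exp 1 * sqrt n)) = exp (- c) * (2 / exp 1)"
          using n by (simp add: field_simps)
        then show ?thesis unfolding \<nu>_eq by (simp only: power_mult_distrib[symmetric])
      qed
      moreover have "exp (4 * (c + G)) ^ d * exp (9 / 8 * ?Z) *
          (\<nu> * (exp (- G) ^ d * (2 / (exp 1 * sqrt n)) ^ d * exp (Y - ?Z)))
        = exp (4 * (c + G)) ^ d * exp (- G) ^ d * (\<nu> * (2 / (exp 1 * sqrt n)) ^ d) *
          (exp (9 / 8 * ?Z) * exp (Y - ?Z))" by (simp only: mult_ac)
      ultimately show ?thesis unfolding eG by (simp only: power_mult_distrib mult_ac)
    qed
    also have "\<dots> = V ^ 4 * (\<nu> * ?l)"
      unfolding V block_bound_rough_def power_mult_distrib exp_of_nat_mult[symmetric] by simp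
    finally have "ennreal (exp (T / 16) + ((3/5) ^ 4) ^ d * exp (?Z / 8 + Y)) \<le> ennreal (V ^ 4 * (\<nu> * ?l))"
      by (rule ennreal_leI)
    also have "\<dots> = ennreal (V ^ 4) * (ennreal \<nu> * ennreal ?l)"
      using \<nu> n by (subst ennreal_mult[symmetric], simp, simp, subst ennreal_mult[symmetric]) auto
    also have "\<dots> \<le> ennreal (V ^ 4) * (ennreal \<nu> * ?den)"
      using slab_denominator_ge[OF fin n, of g L G \<theta> y] g_ge \<theta>
      by (intro mult_left_mono) (auto simp: d_def Y_def Z_def)
    also have "\<dots> \<le> ennreal (V ^ 4) * (1 + ennreal \<nu> * ?den)" by (intro mult_left_mono) auto
    finally show ?thesis using num_le by (rule order_trans[rotated])
  next
    assume V: "V = block_bound_smooth T d (Z y)"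
    let ?w = "(3/5) ^ d * exp (9 / 32 * ?Z)"
    have "exp (T / 16) + ((3/5) ^ 4) ^ d * exp (?Z / 8 + Y) \<le> exp T + ((3/5) ^ 4) ^ d * exp (T + 9 / 8 * ?Z)"
      using TZY Y_le by (intro add_mono mult_left_mono) auto
    also have "\<dots> = exp T * (1 + ?w ^ 4)"
    proof -
      have "?w ^ 4 = ((3/5) ^ 4) ^ d * exp (9 / 8 * ?Z)"
        by (simp only: power_mult_distrib exp_of_nat_mult[symmetric] power_mult[symmetric] mult.commute[of d]) simp
      then show ?thesis by (simp only: exp_add distrib_left mult_1_right mult.left_commute)
    qed
    also have "\<dots> \<le> exp T * (1 + ?w) ^ 4"
    proof (intro mult_left_mono)
      have "1 + w ^ 4 \<le> (1 + w) ^ 4" if "0 \<le> w" for w :: real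
      proof -
        have "(1 + w) ^ 4 = 1 + w ^ 4 + (4 * w + 6 * w ^ 2 + 4 * w ^ 3)" by algebra
        then show ?thesis using that by simp
      qed
      then show "1 + ?w ^ 4 \<le> (1 + ?w) ^ 4" by simp
    qed auto
    also have "\<dots> = V ^ 4"
      unfolding V block_bound_smooth_def power_mult_distrib exp_of_nat_mult[symmetric] by simp
    finally have "ennreal (exp (T / 16) + ((3/5) ^ 4) ^ d * exp (?Z / 8 + Y)) \<le> ennreal (V ^ 4) * 1"
      by (simp add: ennreal_leI del: ennreal_plus)
    also have "\<dots> \<le> ennreal (V ^ 4) * (1 + ennreal \<nu> * ?den)" by (intro mult_left_mono) auto
    finally show ?thesis using num_le by (rule order_trans[rotated])
  qed
qed

section \<open>The white noise model\<close>

lemma (in product_prob_space) nn_integral_PiM_prod: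
  assumes "finite F" "F \<subseteq> I" and h[measurable]: "\<And>i. i \<in> F \<Longrightarrow> h i \<in> borel_measurable (M i)"
  shows "(\<integral>\<^sup>+\<omega>. (\<Prod>i\<in>F. h i (\<omega> i)) \<partial>PiM I M) = (\<Prod>i\<in>F. \<integral>\<^sup>+z. h i z \<partial>M i)"
proof -
  have "(\<Prod>i\<in>F. \<integral>\<^sup>+z. h i z \<partial>M i) = (\<integral>\<^sup>+\<omega>. (\<Prod>i\<in>F. h i (\<omega> i)) \<partial>PiM F M)"
    using assms by (intro product_nn_integral_prod[symmetric])
  also have "\<dots> = (\<integral>\<^sup>+\<omega>. (\<Prod>i\<in>F. h i (\<omega> i)) \<partial>distr (PiM I M) (PiM F M) (\<lambda>x. restrict x F))"
    using assms by (simp add: distr_PiM_restrict_finite)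
  also have "\<dots> = (\<integral>\<^sup>+\<omega>. (\<Prod>i\<in>F. h i (restrict \<omega> F i)) \<partial>PiM I M)"
    using assms by (intro nn_integral_distr) (auto intro!: measurable_restrict_subset borel_measurable_prod_ennreal
      measurable_compose[OF measurable_component_singleton])
  also have "\<dots> = (\<integral>\<^sup>+\<omega>. (\<Prod>i\<in>F. h i (\<omega> i)) \<partial>PiM I M)"
    by (intro nn_integral_cong prod.cong) auto
  finally show ?thesis by simp
qed

lemma (in product_prob_space) indep_vars_coordinates: "indep_vars M (\<lambda>i \<omega>. \<omega> i) I" if "I \<noteq> {}"
proof (subst indep_vars_iff_distr_eq_PiM'[OF that])
  have "distr (PiM I M) (PiM I M) (\<lambda>x. \<lambda>i\<in>I. x i) = distr (PiM I M) (PiM I M) (\<lambda>x. x)"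
    by (intro distr_cong) (auto simp: space_PiM)
  also have "\<dots> = PiM I M" by (rule distr_id)
  also have "\<dots> = PiM I (\<lambda>i. distr (PiM I M) (M i) (\<lambda>\<omega>. \<omega> i))"
    by (intro PiM_cong refl) (simp add: PiM_component)
  finally show "distr (PiM I M) (PiM I M) (\<lambda>x. \<lambda>i\<in>I. x i) = PiM I (\<lambda>i. distr (PiM I M) (M i) (\<lambda>\<omega>. \<omega> i))" .
qed auto

text \<open>Independence of disjoint groups of coordinates, also when the index set is infinite.\<close>

lemma (in product_prob_space) nn_integral_PiM_blocks:
  assumes "finite B" "\<And>j. j \<in> B \<Longrightarrow> K j \<subseteq> I" "disjoint_family_on K B"
    and h[measurable]: "\<And>j. j \<in> B \<Longrightarrow> h j \<in> borel_measurable (PiM (K j) M)"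
  shows "(\<integral>\<^sup>+\<omega>. (\<Prod>j\<in>B. h j (restrict \<omega> (K j))) \<partial>PiM I M) = (\<Prod>j\<in>B. \<integral>\<^sup>+\<omega>. h j (restrict \<omega> (K j)) \<partial>PiM I M)"
proof (cases "I = {}")
  case True
  have "(\<integral>\<^sup>+\<omega>. f \<omega> \<partial>PiM I M) = f (\<lambda>_. undefined)" for f :: "_ \<Rightarrow> ennreal"
    using True by (simp add: PiM_empty nn_integral_count_space_finite)
  then show ?thesis by simp
next
  case False
  have "indep_vars (\<lambda>j. PiM (K j) M) (\<lambda>j \<omega>. restrict (\<lambda>i. \<omega> i) (K j)) B"
    by (rule indep_vars_restrict[OF indep_vars_coordinates[OF False]]) (use assms in auto)
  then have "indep_vars (\<lambda>_. borel) (\<lambda>j \<omega>. h j (restrict \<omega> (K j))) B"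
    by (rule indep_vars_compose2) (rule h)
  then show ?thesis using assms by (intro indep_vars_nn_integral) auto
qed

abbreviation noise :: "'i set \<Rightarrow> ('i \<Rightarrow> real) measure" where
  "noise \<Lambda> \<equiv> (\<Pi>\<^sub>M i\<in>\<Lambda>. std_normal)"

definition observe :: "'i set \<Rightarrow> nat \<Rightarrow> ('i \<Rightarrow> real) \<Rightarrow> ('i \<Rightarrow> real) \<Rightarrow> ('i \<Rightarrow> real)" where
  "observe \<Lambda> n \<theta> \<epsilon> = (\<lambda>i\<in>\<Lambda>. \<theta> i + real n powr (-1/2) * \<epsilon> i)"

interpretation noise: product_prob_space "\<lambda>_. std_normal" \<Lambda> for \<Lambda> :: "'i set"
  by (intro product_prob_spaceI prob_space_normal_density) simp

lemma measurable_std_normal: "measurable M std_normal = measurable M borel"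
  by (rule measurable_cong_sets) simp_all

lemma observe_measurable[measurable]: "observe \<Lambda> n \<theta> \<in> measurable (noise \<Lambda>) (obs_space \<Lambda>)"
  unfolding observe_def obs_space_def by measurable

lemma white_noise_eq: "white_noise \<Lambda> n \<theta> = distr (noise \<Lambda>) (obs_space \<Lambda>) (observe \<Lambda> n \<theta>)"
  by (simp add: white_noise_def observe_def[abs_def])

lemma sets_white_noise[simp, measurable_cong]: "sets (white_noise \<Lambda> n \<theta>) = sets (obs_space \<Lambda>)"
  by (simp add: white_noise_eq)

lemma space_white_noise[simp]: "space (white_noise \<Lambda> n \<theta>) = space (obs_space \<Lambda>)"
  by (simp add: white_noise_eq)

lemma prob_space_white_noise: "prob_space (white_noise \<Lambda> n \<theta>)"
  unfolding white_noise_eq by (rule noise.prob_space_distr) measurable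

lemma obs_component[measurable]: "i \<in> \<Lambda> \<Longrightarrow> (\<lambda>y. y i) \<in> borel_measurable (obs_space \<Lambda>)"
  unfolding obs_space_def by measurable

lemma measurable_white_noise_eq[simp]: "measurable (white_noise \<Lambda> n \<theta>) N = measurable (obs_space \<Lambda>) N"
  by (rule measurable_cong_sets) auto

lemma lik_prod_measurable:
  assumes "F \<subseteq> \<Lambda>"
  shows "(\<lambda>y. \<Prod>i\<in>F. lik n (y i) (\<theta> i)) \<in> borel_measurable (obs_space \<Lambda>)"
  using assms by (intro borel_measurable_prod lik_measurable borel_measurable_const obs_component) auto

lemma lik_prod_measurable':
  assumes "F \<subseteq> \<Lambda>"
  shows "(\<lambda>y. ennreal (\<Prod>i\<in>F. lik n (y i) (\<theta> i))) \<in> borel_measurable (white_noise \<Lambda> m \<eta>)"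
  by (subst measurable_white_noise_eq)
    (intro measurable_compose[OF lik_prod_measurable[OF assms] measurable_ennreal])

text \<open>Both measures are compared on finite-dimensional rectangles \<open>?E\<close>, where the
  integral factorises and the one-dimensional shift formula applies to each coordinate.\<close>

lemma white_noise_density:
  assumes F: "finite F" "F \<subseteq> \<Lambda>" and supp: "\<And>i. i \<in> \<Lambda> - F \<Longrightarrow> \<theta> i = 0" and n: "0 < n"
  shows "white_noise \<Lambda> n \<theta> =
    density (white_noise \<Lambda> n (\<lambda>_. 0)) (\<lambda>y. ennreal (\<Prod>i\<in>F. lik n (y i) (\<theta> i)))"
proof (rule measure_eqI_PiM_infinite[where M="\<lambda>_. borel" and I=\<Lambda>])
  show "finite_measure (white_noise \<Lambda> n \<theta>)"
    using prob_space_white_noise by (rule prob_space.finite_measure)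
  fix A :: "_ \<Rightarrow> real set" and J assume J: "finite J" "J \<subseteq> \<Lambda>" and A: "\<And>i. i \<in> J \<Longrightarrow> A i \<in> sets borel"
  let ?E = "prod_emb \<Lambda> (\<lambda>_. borel) J (Pi\<^sub>E J A)" and ?K = "J \<union> F" and ?s = "real n powr (-1/2)"
  \<comment> \<open>The factor of coordinate \<open>i\<close>; coordinates of \<open>F - J\<close> are unconstrained. In units of the noise,
    the signal at \<open>i\<close> is the shift \<open>\<theta> i * sqrt n\<close>.\<close>
  define h :: "_ \<Rightarrow> real \<Rightarrow> ennreal" where "h i x = (if i \<in> J then indicator (A i) (?s * x) else 1)" for i x
  have s: "?s * sqrt n = 1" "?s * n = sqrt n"
  proof -
    have "?s * n powr (1/2) = 1" using n by (simp add: powr_add[symmetric])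
    then show "?s * sqrt n = 1" using n by (simp add: powr_half_sqrt)
    have "?s * n powr 1 = n powr (1/2)" by (subst powr_add[symmetric]) simp
    then show "?s * n = sqrt n" using n by (simp add: powr_half_sqrt)
  qed
  have hm[measurable]: "h i \<in> borel_measurable borel" for i
    unfolding h_def using A by (cases "i \<in> J") auto
  have E[measurable]: "?E \<in> sets (obs_space \<Lambda>)"
    unfolding obs_space_def using J A by (intro sets_PiM_I) auto
  have mem: "indicator ?E (observe \<Lambda> n \<theta>' \<epsilon>) = (\<Prod>i\<in>?K. h i (\<epsilon> i + \<theta>' i * sqrt n))" for \<theta>' \<epsilon>
  proof -
    have "observe \<Lambda> n \<theta>' \<epsilon> \<in> ?E \<longleftrightarrow> (\<forall>i\<in>J. ?s * (\<epsilon> i + \<theta>' i * sqrt n) \<in> A i)"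
    proof -
      have "?s * (\<epsilon> i + \<theta>' i * sqrt n) = \<theta>' i + ?s * \<epsilon> i" for i
      proof -
        have "?s * (\<epsilon> i + \<theta>' i * sqrt n) = ?s * \<epsilon> i + \<theta>' i * (?s * sqrt n)"
          by (simp only: distrib_left mult.left_commute)
        then show ?thesis unfolding s(1) by simp
      qed
      then show ?thesis using J unfolding prod_emb_def observe_def
        by (auto simp: space_PiM PiE_iff extensional_def restrict_def subset_eq)
    qed
    moreover have "(\<Prod>i\<in>?K. h i (\<epsilon> i + \<theta>' i * sqrt n)) = (\<Prod>i\<in>J. indicator (A i) (?s * (\<epsilon> i + \<theta>' i * sqrt n)))"
      using F J by (intro prod.mono_neutral_cong_right) (auto simp: h_def)
    moreover have "(\<Prod>i\<in>J. indicator (A i) (x i)) = (if \<forall>i\<in>J. x i \<in> A i then 1 else 0::ennreal)" for x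
      using J(1) by (induction J) (auto simp: indicator_def)
    ultimately show ?thesis by (simp add: indicator_def)
  qed
  have "emeasure (density (white_noise \<Lambda> n (\<lambda>_. 0)) (\<lambda>y. ennreal (\<Prod>i\<in>F. lik n (y i) (\<theta> i)))) ?E
    = (\<integral>\<^sup>+\<epsilon>. ennreal (\<Prod>i\<in>F. lik n (observe \<Lambda> n (\<lambda>_. 0) \<epsilon> i) (\<theta> i)) * indicator ?E (observe \<Lambda> n (\<lambda>_. 0) \<epsilon>) \<partial>noise \<Lambda>)"
  proof -
    have [measurable]: "i \<in> F \<Longrightarrow> (\<lambda>y. y i) \<in> borel_measurable (obs_space \<Lambda>)" for i
      using F by (intro obs_component) auto
    have m: "(\<lambda>y. ennreal (\<Prod>i\<in>F. lik n (y i) (\<theta> i))) \<in> borel_measurable (obs_space \<Lambda>)"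
      by measurable
    then have "emeasure (density (white_noise \<Lambda> n (\<lambda>_. 0)) (\<lambda>y. ennreal (\<Prod>i\<in>F. lik n (y i) (\<theta> i)))) ?E
      = (\<integral>\<^sup>+y. ennreal (\<Prod>i\<in>F. lik n (y i) (\<theta> i)) * indicator ?E y \<partial>white_noise \<Lambda> n (\<lambda>_. 0))"
      by (intro emeasure_density) (auto cong: measurable_cong_sets)
    then show ?thesis unfolding white_noise_eq
      using m by (subst (asm) nn_integral_distr) auto
  qed
  also have "\<dots> = (\<integral>\<^sup>+\<epsilon>. (\<Prod>i\<in>?K. h i (\<epsilon> i) * ennreal (exp ((\<theta> i * sqrt n) * \<epsilon> i - (\<theta> i * sqrt n)\<^sup>2 / 2))) \<partial>noise \<Lambda>)"
  proof (intro nn_integral_cong)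
    fix \<epsilon> :: "_ \<Rightarrow> real"
    have "ennreal (\<Prod>i\<in>F. lik n (observe \<Lambda> n (\<lambda>_. 0) \<epsilon> i) (\<theta> i))
        = (\<Prod>i\<in>F. ennreal (exp ((\<theta> i * sqrt n) * \<epsilon> i - (\<theta> i * sqrt n)\<^sup>2 / 2)))"
      using F n s(2) by (subst prod_ennreal[symmetric])
        (auto simp: lik_def observe_def power_mult_distrib subset_eq field_simps intro!: prod.cong)
    also have "\<dots> = (\<Prod>i\<in>?K. ennreal (exp ((\<theta> i * sqrt n) * \<epsilon> i - (\<theta> i * sqrt n)\<^sup>2 / 2)))"
      using F J supp by (intro prod.mono_neutral_left) auto
    finally show "ennreal (\<Prod>i\<in>F. lik n (observe \<Lambda> n (\<lambda>_. 0) \<epsilon> i) (\<theta> i)) * indicator ?E (observe \<Lambda> n (\<lambda>_. 0) \<epsilon>)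
      = (\<Prod>i\<in>?K. h i (\<epsilon> i) * ennreal (exp ((\<theta> i * sqrt n) * \<epsilon> i - (\<theta> i * sqrt n)\<^sup>2 / 2)))"
      by (simp add: mem prod.distrib mult.commute)
  qed
  also have "\<dots> = (\<Prod>i\<in>?K. \<integral>\<^sup>+z. h i z * ennreal (exp ((\<theta> i * sqrt n) * z - (\<theta> i * sqrt n)\<^sup>2 / 2)) \<partial>std_normal)"
    using F J by (intro noise.nn_integral_PiM_prod) auto
  also have "\<dots> = (\<Prod>i\<in>?K. \<integral>\<^sup>+z. h i (z + \<theta> i * sqrt n) \<partial>std_normal)"
    by (intro prod.cong refl) (simp add: std_normal_shift[OF hm] add.commute)
  also have "\<dots> = (\<integral>\<^sup>+\<epsilon>. (\<Prod>i\<in>?K. h i (\<epsilon> i + \<theta> i * sqrt n)) \<partial>noise \<Lambda>)"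
    using F J by (intro noise.nn_integral_PiM_prod[symmetric]) auto
  also have "\<dots> = (\<integral>\<^sup>+\<epsilon>. indicator ?E (observe \<Lambda> n \<theta> \<epsilon>) \<partial>noise \<Lambda>)"
    by (simp add: mem)
  also have "\<dots> = (\<integral>\<^sup>+y. indicator ?E y \<partial>white_noise \<Lambda> n \<theta>)"
    unfolding white_noise_eq by (subst nn_integral_distr) auto
  also have "\<dots> = emeasure (white_noise \<Lambda> n \<theta>) ?E" by (intro nn_integral_indicator) simp
  finally show "emeasure (white_noise \<Lambda> n \<theta>) ?E =
     emeasure (density (white_noise \<Lambda> n (\<lambda>_. 0)) (\<lambda>y. ennreal (\<Prod>i\<in>F. lik n (y i) (\<theta> i)))) ?E" ..
qed (simp_all add: obs_space_def)

section \<open>Absolute continuity of the white noise laws\<close>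

text \<open>The sets that can be approximated form a sigma-algebra; the approximation is simultaneous
  for two measures.\<close>

lemma algebra_approximates_sigma_sets:
  assumes alg: "algebra \<Omega> \<A>"
    and P: "finite_measure P" "sets P = sigma_sets \<Omega> \<A>"
    and Q: "finite_measure Q" "sets Q = sigma_sets \<Omega> \<A>"
    and B: "B \<in> sigma_sets \<Omega> \<A>" and "0 < e"
  shows "\<exists>C\<in>\<A>. measure P (sym_diff B C) < e \<and> measure Q (sym_diff B C) < e"
  using B \<open>0 < e\<close>
proof (induction arbitrary: e)
  interpret algebra \<Omega> \<A> by fact
  interpret P: finite_measure P by fact
  interpret Q: finite_measure Q by fact
  have sub: "a \<subseteq> \<Omega>" if "a \<in> sigma_sets \<Omega> \<A>" for a
    using that space_closed sigma_sets_into_sp by blast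
  {
    case (Basic a)
    then show ?case by (intro bexI[of _ a]) auto
  next
    case Empty
    then show ?case by (intro bexI[of _ "{}"]) auto
  next
    case (Compl a)
    then obtain C where C: "C \<in> \<A>" "measure P (sym_diff a C) < e" "measure Q (sym_diff a C) < e" by blast
    have "sym_diff (\<Omega> - a) (\<Omega> - C) = sym_diff a C"
      using sub[OF Compl.hyps] sets_into_space[OF C(1)] by blast
    then show ?case using C by (intro bexI[of _ "\<Omega> - C"]) auto
  next
    case (Union a)
    have a_sets: "a i \<in> sets P" "a i \<in> sets Q" for i using Union.hyps P Q by auto
    let ?U = "\<Union>i. a i" and ?A = "\<lambda>m. \<Union>i<m. a i"
    have tail: "eventually (\<lambda>m. measure M (?U - ?A m) < e / 2) sequentially"
      if "finite_measure M" "\<And>i. a i \<in> sets M" for M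
    proof -
      interpret M: finite_measure M by fact
      have "(\<lambda>m. measure M (?A m)) \<longlonglongrightarrow> measure M (\<Union>m. ?A m)"
        using that by (intro M.finite_Lim_measure_incseq) (auto simp: incseq_def, fastforce)
      also have "(\<Union>m. ?A m) = ?U" by auto
      finally have "eventually (\<lambda>m. measure M (?A m) > measure M ?U - e / 2) sequentially"
        using Union.prems by (intro order_tendstoD) auto
      then show ?thesis
      proof eventually_elim
        case (elim m)
        have "measure M (?U - ?A m) = measure M ?U - measure M (?A m)"
          using that by (intro M.finite_measure_Diff) auto
        then show ?case using elim by simp
      qed
    qed
    obtain m where m: "measure P (?U - ?A m) < e / 2" "measure Q (?U - ?A m) < e / 2"
      using eventually_conj[OF tail[OF P(1) a_sets(1)] tail[OF Q(1) a_sets(2)]]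
      by (auto simp: eventually_sequentially)
    \<comment> \<open>The first \<open>m\<close> sets share the error budget \<open>e / 2\<close>; the \<open>+ 1\<close> covers \<open>m = 0\<close>.\<close>
    define d where "d = e / (2 * (real m + 1))"
    have d: "0 < d" "real m * d \<le> e / 2"
      using Union.prems by (auto simp: d_def field_simps)
    have "\<exists>C. C \<in> \<A> \<and> measure P (sym_diff (a i) C) < d \<and> measure Q (sym_diff (a i) C) < d" for i
      using Union.IH[OF d(1)] by blast
    then obtain C where C: "\<And>i. C i \<in> \<A>" "\<And>i. measure P (sym_diff (a i) (C i)) < d"
      "\<And>i. measure Q (sym_diff (a i) (C i)) < d" by metis
    let ?C = "\<Union>i<m. C i"
    have bound: "measure M (sym_diff ?U ?C) < e"
      if "finite_measure M" and s: "sets M = sigma_sets \<Omega> \<A>" and "measure M (?U - ?A m) < e / 2"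
        and l: "\<And>i. measure M (sym_diff (a i) (C i)) < d" for M
    proof -
      interpret M: finite_measure M by fact
      have s': "a i \<in> sets M" "C i \<in> sets M" for i using Union.hyps C(1) s by auto
      have "measure M (sym_diff ?U ?C) \<le> measure M ((?U - ?A m) \<union> (\<Union>i<m. sym_diff (a i) (C i)))"
        using s' by (intro M.finite_measure_mono) auto
      also have "\<dots> \<le> measure M (?U - ?A m) + measure M (\<Union>i<m. sym_diff (a i) (C i))"
        using s' by (intro measure_Un_le) auto
      also have "measure M (\<Union>i<m. sym_diff (a i) (C i)) \<le> (\<Sum>i<m. measure M (sym_diff (a i) (C i)))"
        using s' by (intro M.finite_measure_subadditive_finite) auto
      also have "\<dots> \<le> (\<Sum>i<m. d)" using l by (intro sum_mono less_imp_le)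
      finally show ?thesis using that(3) d(2) by simp
    qed
    show ?case
      using bound[OF P m(1) C(2)] bound[OF Q m(2) C(3)] C(1)
      by (intro bexI[of _ ?C]) auto
  }
qed

text \<open>A cylinder is described by the finitely many coordinates that decide membership, rather than
  as a preimage. This makes it immediate that cylinders form an algebra and that a cylinder does not see
  the other coordinates of \<open>\<theta>\<close>.\<close>

definition depends_on :: "('i \<Rightarrow> real) set \<Rightarrow> 'i set \<Rightarrow> ('i \<Rightarrow> real) set \<Rightarrow> bool" where
  "depends_on \<Omega> F C \<longleftrightarrow> (\<forall>x\<in>\<Omega>. \<forall>y\<in>\<Omega>. (\<forall>i\<in>F. x i = y i) \<longrightarrow> (x \<in> C \<longleftrightarrow> y \<in> C))"

definition cylinders :: "'i set \<Rightarrow> ('i \<Rightarrow> real) set set" where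
  "cylinders \<Lambda> = {C \<in> sets (obs_space \<Lambda>).
     \<exists>F. finite F \<and> F \<subseteq> \<Lambda> \<and> depends_on (space (obs_space \<Lambda>)) F C}"

lemma algebra_cylinders: "algebra (space (obs_space \<Lambda>)) (cylinders \<Lambda>)"
proof (subst algebra_iff_Un, intro conjI ballI)
  let ?\<Omega> = "space (obs_space \<Lambda>)"
  show "cylinders \<Lambda> \<subseteq> Pow ?\<Omega>" using sets.sets_into_space by (auto simp: cylinders_def)
  show "{} \<in> cylinders \<Lambda>" by (auto simp: cylinders_def depends_on_def)
  fix C assume "C \<in> cylinders \<Lambda>"
  then obtain F where C: "C \<in> sets (obs_space \<Lambda>)" "finite F" "F \<subseteq> \<Lambda>" "depends_on ?\<Omega> F C"
    unfolding cylinders_def by blast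
  have "depends_on ?\<Omega> F (?\<Omega> - C)"
    using C(4) unfolding depends_on_def by blast
  then show "?\<Omega> - C \<in> cylinders \<Lambda>" using C(1-3) unfolding cylinders_def by blast
  fix C' assume "C' \<in> cylinders \<Lambda>"
  then obtain F' where C': "C' \<in> sets (obs_space \<Lambda>)" "finite F'" "F' \<subseteq> \<Lambda>" "depends_on ?\<Omega> F' C'"
    unfolding cylinders_def by blast
  have "depends_on ?\<Omega> (F \<union> F') (C \<union> C')"
    using C(4) C'(4) unfolding depends_on_def by (simp only: Un_iff ball_Un) blast
  moreover have "C \<union> C' \<in> sets (obs_space \<Lambda>)" "finite (F \<union> F')" "F \<union> F' \<subseteq> \<Lambda>" using C C' by auto
  ultimately show "C \<union> C' \<in> cylinders \<Lambda>" unfolding cylinders_def by blast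
qed

lemma sets_obs_space_cylinders: "sets (obs_space \<Lambda>) = sigma_sets (space (obs_space \<Lambda>)) (cylinders \<Lambda>)"
proof (rule antisym)
  have "sets (obs_space \<Lambda>) = sigma_sets (space (obs_space \<Lambda>))
      {{f\<in>\<Pi>\<^sub>E i\<in>\<Lambda>. UNIV. f i \<in> A} | i A. i \<in> \<Lambda> \<and> A \<in> sets (borel :: real measure)}"
    unfolding obs_space_def by (subst sets_PiM_single) (simp add: space_PiM)
  also have "\<dots> \<subseteq> sigma_sets (space (obs_space \<Lambda>)) (cylinders \<Lambda>)"
  proof (intro sigma_sets_mono subsetI sigma_sets.Basic)
    fix X assume "X \<in> {{f\<in>\<Pi>\<^sub>E i\<in>\<Lambda>. UNIV. f i \<in> A} | i A. i \<in> \<Lambda> \<and> A \<in> sets (borel :: real measure)}"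
    then obtain i A where X: "X = {f\<in>\<Pi>\<^sub>E i\<in>\<Lambda>. UNIV. f i \<in> A}" "i \<in> \<Lambda>" "A \<in> sets borel" by blast
    then have "X = {f\<in>space (obs_space \<Lambda>). f i \<in> A}" by (simp add: obs_space_def space_PiM)
    moreover have "{f\<in>space (obs_space \<Lambda>). f i \<in> A} \<in> sets (obs_space \<Lambda>)"
      using X(2,3) by measurable
    moreover have "depends_on (space (obs_space \<Lambda>)) {i} {f\<in>space (obs_space \<Lambda>). f i \<in> A}"
      by (simp add: depends_on_def)
    ultimately show "X \<in> cylinders \<Lambda>" using X(2) unfolding cylinders_def by blast
  qed
  finally show "sets (obs_space \<Lambda>) \<subseteq> sigma_sets (space (obs_space \<Lambda>)) (cylinders \<Lambda>)" .
  show "sigma_sets (space (obs_space \<Lambda>)) (cylinders \<Lambda>) \<subseteq> sets (obs_space \<Lambda>)"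
    by (rule sets.sigma_sets_subset) (auto simp: cylinders_def)
qed

lemma white_noise_cylinder_eq:
  assumes "C \<in> cylinders \<Lambda>"
  obtains F where "finite F" "F \<subseteq> \<Lambda>"
    "emeasure (white_noise \<Lambda> n \<theta>) C = emeasure (white_noise \<Lambda> n (\<lambda>i. if i \<in> F then \<theta> i else 0)) C"
proof -
  obtain F where F: "C \<in> sets (obs_space \<Lambda>)" "finite F" "F \<subseteq> \<Lambda>"
    "depends_on (space (obs_space \<Lambda>)) F C"
    using assms unfolding cylinders_def by blast
  let ?\<theta> = "\<lambda>i. if i \<in> F then \<theta> i else 0"
  have "observe \<Lambda> n \<theta> \<epsilon> \<in> C \<longleftrightarrow> observe \<Lambda> n ?\<theta> \<epsilon> \<in> C" for \<epsilon>
  proof -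
    have sp: "observe \<Lambda> n \<theta> \<epsilon> \<in> space (obs_space \<Lambda>)" for \<theta>
      by (auto simp: observe_def obs_space_def space_PiM)
    have "observe \<Lambda> n \<theta> \<epsilon> i = observe \<Lambda> n ?\<theta> \<epsilon> i" if "i \<in> F" for i
      using that F(3) by (auto simp: observe_def)
    then show ?thesis using F(4) sp unfolding depends_on_def by blast
  qed
  then have "observe \<Lambda> n \<theta> -` C = observe \<Lambda> n ?\<theta> -` C" by auto
  then have "emeasure (white_noise \<Lambda> n \<theta>) C = emeasure (white_noise \<Lambda> n ?\<theta>) C"
    using F(1) by (simp add: white_noise_eq emeasure_distr)
  with F(2,3) show thesis by (rule that)
qed

text \<open>The square of the likelihood ratio at \<open>\<theta>\<close> is a constant times the
  likelihood ratio at \<open>2 * \<theta>\<close>, which integrates to one.\<close>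

lemma lik_second_moment:
  assumes F: "finite F" "F \<subseteq> \<Lambda>" and n: "0 < n"
  shows "(\<integral>\<^sup>+y. ennreal ((\<Prod>i\<in>F. lik n (y i) (\<theta> i))\<^sup>2) \<partial>white_noise \<Lambda> n (\<lambda>_. 0))
    = ennreal (exp (n * (\<Sum>i\<in>F. (\<theta> i)\<^sup>2)))"
proof -
  let ?\<theta> = "\<lambda>i. if i \<in> F then 2 * \<theta> i else 0"
  have "(\<Prod>i\<in>F. lik n (y i) (\<theta> i))\<^sup>2 = exp (n * (\<Sum>i\<in>F. (\<theta> i)\<^sup>2)) * (\<Prod>i\<in>F. lik n (y i) (?\<theta> i))" for y
  proof -
    have "(lik n (y i) (\<theta> i))\<^sup>2 = exp (n * (\<theta> i)\<^sup>2) * lik n (y i) (2 * \<theta> i)" for i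
      by (simp add: lik_def power2_eq_square exp_add[symmetric] algebra_simps)
    then have "(\<Prod>i\<in>F. lik n (y i) (\<theta> i))\<^sup>2 = (\<Prod>i\<in>F. exp (n * (\<theta> i)\<^sup>2) * lik n (y i) (2 * \<theta> i))"
      by (simp only: prod_power_distrib)
    also have "\<dots> = exp (n * (\<Sum>i\<in>F. (\<theta> i)\<^sup>2)) * (\<Prod>i\<in>F. lik n (y i) (?\<theta> i))"
      using F(1) by (simp add: prod.distrib exp_sum sum_distrib_left cong: prod.cong)
    finally show ?thesis .
  qed
  then have "(\<integral>\<^sup>+y. ennreal ((\<Prod>i\<in>F. lik n (y i) (\<theta> i))\<^sup>2) \<partial>white_noise \<Lambda> n (\<lambda>_. 0))
    = (\<integral>\<^sup>+y. ennreal (exp (n * (\<Sum>i\<in>F. (\<theta> i)\<^sup>2))) * ennreal (\<Prod>i\<in>F. lik n (y i) (?\<theta> i)) \<partial>white_noise \<Lambda> n (\<lambda>_. 0))"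
    by (simp add: ennreal_mult')
  also have "\<dots> = ennreal (exp (n * (\<Sum>i\<in>F. (\<theta> i)\<^sup>2))) * (\<integral>\<^sup>+y. ennreal (\<Prod>i\<in>F. lik n (y i) (?\<theta> i)) \<partial>white_noise \<Lambda> n (\<lambda>_. 0))"
    by (rule nn_integral_cmult[OF lik_prod_measurable'[OF F(2)]])
  also have "(\<integral>\<^sup>+y. ennreal (\<Prod>i\<in>F. lik n (y i) (?\<theta> i)) \<partial>white_noise \<Lambda> n (\<lambda>_. 0))
    = emeasure (white_noise \<Lambda> n ?\<theta>) (space (obs_space \<Lambda>))"
  proof -
    have "white_noise \<Lambda> n ?\<theta> = density (white_noise \<Lambda> n (\<lambda>_. 0)) (\<lambda>y. ennreal (\<Prod>i\<in>F. lik n (y i) (?\<theta> i)))"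
      by (rule white_noise_density[OF F _ n]) simp
    then have "emeasure (white_noise \<Lambda> n ?\<theta>) (space (obs_space \<Lambda>))
      = (\<integral>\<^sup>+y. ennreal (\<Prod>i\<in>F. lik n (y i) (?\<theta> i)) * indicator (space (obs_space \<Lambda>)) y \<partial>white_noise \<Lambda> n (\<lambda>_. 0))"
      by (simp only:) (rule emeasure_density[OF lik_prod_measurable'[OF F(2)]], simp)
    also have "\<dots> = (\<integral>\<^sup>+y. ennreal (\<Prod>i\<in>F. lik n (y i) (?\<theta> i)) \<partial>white_noise \<Lambda> n (\<lambda>_. 0))"
      by (intro nn_integral_cong) simp
    finally show ?thesis by simp
  qed
  also have "\<dots> = 1" using prob_space.emeasure_space_1[OF prob_space_white_noise, of \<Lambda> n ?\<theta>] by simp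
  finally show ?thesis by simp
qed

text \<open>On cylinders the law at \<open>\<theta>\<close> has a density \<open>f\<close> whose second
  moment is at most \<open>K\<close>, uniformly in the cylinder. The inequality \<open>f \<le> l +
  f\<^sup>2 / l\<close> gives \<open>P C \<le> l * Q C + K / l\<close> for every \<open>l > 0\<close>,
  and this passes to all measurable sets by approximation. For a null set of \<open>Q\<close>, let
  \<open>l\<close> tend to infinity.\<close>

lemma white_noise_absolutely_continuous:
  assumes \<theta>: "\<And>F. finite F \<Longrightarrow> F \<subseteq> \<Lambda> \<Longrightarrow> (\<Sum>i\<in>F. (\<theta> i)\<^sup>2) \<le> S" and n: "0 < n"
  shows "absolutely_continuous (white_noise \<Lambda> n (\<lambda>_. 0)) (white_noise \<Lambda> n \<theta>)"
  unfolding absolutely_continuous_def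
proof
  let ?Q = "white_noise \<Lambda> n (\<lambda>_. 0)" and ?P = "white_noise \<Lambda> n \<theta>"
  interpret P: prob_space ?P by (rule prob_space_white_noise)
  interpret Q: prob_space ?Q by (rule prob_space_white_noise)
  define K where "K = exp (n * S)"
  have cyl: "measure ?P C \<le> l * measure ?Q C + K / l" if C: "C \<in> cylinders \<Lambda>" and l: "0 < l" for C l
  proof -
    obtain F where F: "finite F" "F \<subseteq> \<Lambda>"
      and eq: "emeasure ?P C = emeasure (white_noise \<Lambda> n (\<lambda>i. if i \<in> F then \<theta> i else 0)) C"
      using white_noise_cylinder_eq[OF C] by metis
    have [measurable]: "C \<in> sets (obs_space \<Lambda>)" using C by (simp add: cylinders_def)
    let ?f = "\<lambda>y. \<Prod>i\<in>F. lik n (y i) (\<theta> i)"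
    have [measurable]: "?f \<in> borel_measurable (obs_space \<Lambda>)" by (rule lik_prod_measurable[OF F(2)])
    have "emeasure ?P C = (\<integral>\<^sup>+y. ennreal (?f y) * indicator C y \<partial>?Q)"
    proof -
      have "white_noise \<Lambda> n (\<lambda>i. if i \<in> F then \<theta> i else 0)
          = density ?Q (\<lambda>y. ennreal (\<Prod>i\<in>F. lik n (y i) (if i \<in> F then \<theta> i else 0)))"
        by (rule white_noise_density[OF F _ n]) simp
      also have "\<dots> = density ?Q (\<lambda>y. ennreal (?f y))" by (simp cong: prod.cong)
      finally show ?thesis unfolding eq
        by (simp only:) (rule emeasure_density[OF lik_prod_measurable'[OF F(2)]], simp)
    qed
    also have "\<dots> \<le> (\<integral>\<^sup>+y. ennreal l * indicator C y + ennreal (1 / l) * ennreal ((?f y)\<^sup>2) \<partial>?Q)"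
    proof (intro nn_integral_mono)
      fix y
      have "?f y \<le> l + (?f y)\<^sup>2 / l"
      proof -
        have "0 \<le> (?f y - l)\<^sup>2 + ?f y * l" using l by (auto intro!: add_nonneg_nonneg mult_nonneg_nonneg prod_nonneg)
        then show ?thesis using l by (simp add: power2_eq_square field_simps)
      qed
      then have "ennreal (?f y) \<le> ennreal (l + 1 / l * (?f y)\<^sup>2)" by (intro ennreal_leI) simp
      also have "\<dots> = ennreal l + ennreal (1 / l * (?f y)\<^sup>2)" using l by (intro ennreal_plus) auto
      also have "ennreal (1 / l * (?f y)\<^sup>2) = ennreal (1 / l) * ennreal ((?f y)\<^sup>2)"
        using l by (intro ennreal_mult) auto
      finally have "ennreal (?f y) \<le> ennreal l + ennreal (1 / l) * ennreal ((?f y)\<^sup>2)" .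
      then show "ennreal (?f y) * indicator C y \<le> ennreal l * indicator C y + ennreal (1 / l) * ennreal ((?f y)\<^sup>2)"
        by (simp add: indicator_def)
    qed
    also have "\<dots> = ennreal l * emeasure ?Q C + ennreal (1 / l) * ennreal (exp (n * (\<Sum>i\<in>F. (\<theta> i)\<^sup>2)))"
    proof -
      have m: "(\<lambda>y. ennreal ((?f y)\<^sup>2)) \<in> borel_measurable ?Q"
        by (subst measurable_white_noise_eq) (intro measurable_compose[OF _ measurable_ennreal]
          borel_measurable_power lik_prod_measurable[OF F(2)])
      have "(\<integral>\<^sup>+y. ennreal l * indicator C y + ennreal (1 / l) * ennreal ((?f y)\<^sup>2) \<partial>?Q)
        = (\<integral>\<^sup>+y. ennreal l * indicator C y \<partial>?Q) + (\<integral>\<^sup>+y. ennreal (1 / l) * ennreal ((?f y)\<^sup>2) \<partial>?Q)"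
        by (rule nn_integral_add) (simp, rule borel_measurable_times_ennreal[OF borel_measurable_const m])
      also have "(\<integral>\<^sup>+y. ennreal (1 / l) * ennreal ((?f y)\<^sup>2) \<partial>?Q) = ennreal (1 / l) * ennreal (exp (n * (\<Sum>i\<in>F. (\<theta> i)\<^sup>2)))"
        unfolding nn_integral_cmult[OF m] lik_second_moment[OF F n] ..
      also have "(\<integral>\<^sup>+y. ennreal l * indicator C y \<partial>?Q) = ennreal l * emeasure ?Q C"
        by (rule nn_integral_cmult_indicator) simp
      finally show ?thesis .
    qed
    also have "\<dots> \<le> ennreal l * ennreal (measure ?Q C) + ennreal (1 / l) * ennreal K"
      using \<theta>[OF F] n by (auto simp: Q.emeasure_eq_measure K_def intro!: add_mono mult_left_mono ennreal_leI)
    also have "\<dots> = ennreal (l * measure ?Q C + K / l)"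
      using l by (simp add: ennreal_mult[symmetric] ennreal_plus[symmetric] K_def del: ennreal_plus)
    finally have "ennreal (measure ?P C) \<le> ennreal (l * measure ?Q C + K / l)"
      by (simp only: P.emeasure_eq_measure)
    moreover have "0 \<le> l * measure ?Q C + K / l" using l by (auto simp: K_def)
    ultimately show ?thesis by (simp only: ennreal_le_iff)
  qed
  fix B assume B: "B \<in> null_sets ?Q"
  then have [measurable]: "B \<in> sets (obs_space \<Lambda>)" by auto
  have B0: "measure ?Q B = 0" using B by (simp add: null_sets_def measure_def)
  have "measure ?P B \<le> 0 + d" if d: "0 < d" for d :: real
  proof -
    define l where "l = 2 * K / d + 1"
    have l: "0 < l" "K / l \<le> d / 2" using d by (auto simp: l_def K_def field_simps add_pos_pos)
    define e where "e = d / 2 / (l + 1)"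
    have "l + 1 \<noteq> 0" using l by linarith
    then have "e * (l + 1) = d / 2" by (rule nonzero_eq_divide_eq[THEN iffD1, OF _ e_def])
    then have "(l + 1) * e = d / 2" by (simp only: mult.commute)
    moreover have "0 < e" using d l by (simp add: e_def add_pos_pos)
    ultimately have e: "0 < e" "(l + 1) * e = d / 2" by simp_all
    obtain C where C: "C \<in> cylinders \<Lambda>" "measure ?P (sym_diff B C) < e" "measure ?Q (sym_diff B C) < e"
      using algebra_approximates_sigma_sets[OF algebra_cylinders P.finite_measure_axioms _ Q.finite_measure_axioms _ _ e(1)]
        sets_obs_space_cylinders[of \<Lambda>] by (metis \<open>B \<in> sets (obs_space \<Lambda>)\<close> sets_white_noise)
    have Cs[measurable]: "C \<in> sets (obs_space \<Lambda>)" using C by (simp add: cylinders_def)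
    have "measure ?P B \<le> measure ?P (C \<union> sym_diff B C)" by (intro P.finite_measure_mono) auto
    also have "\<dots> \<le> measure ?P C + measure ?P (sym_diff B C)" by (intro measure_Un_le) auto
    also have "measure ?P C \<le> l * measure ?Q C + K / l" by (rule cyl[OF C(1) l(1)])
    also have "measure ?Q C \<le> measure ?Q (B \<union> sym_diff B C)" by (intro Q.finite_measure_mono) auto
    also have "\<dots> \<le> measure ?Q B + measure ?Q (sym_diff B C)" by (intro measure_Un_le) auto
    finally have "measure ?P B \<le> l * (measure ?Q B + measure ?Q (sym_diff B C)) + K / l + measure ?P (sym_diff B C)"
      using l by (simp add: mult_left_mono)
    also have "\<dots> \<le> l * e + d / 2 + e" using C l B0 by (intro add_mono mult_left_mono) auto
    also have "\<dots> = d" using e(2) by (simp add: algebra_simps)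
    finally show ?thesis by simp
  qed
  then have "measure ?P B \<le> 0" by (rule field_le_epsilon)
  then have "measure ?P B = 0" using measure_nonneg[of ?P B] by linarith
  then show "B \<in> null_sets ?P" by (intro null_setsI) (auto simp: P.emeasure_eq_measure)
qed

section \<open>The spike and slab prior\<close>

text \<open>Integration against a mixture, for a measure that is known only through its values on
  sets.\<close>

lemma nn_integral_mixture:
  assumes sets: "sets N = sets M" "sets N' = sets M"
    and eq: "\<And>A. A \<in> sets M \<Longrightarrow> emeasure M A = a * emeasure N A + b * emeasure N' A"
    and h: "h \<in> borel_measurable M"
  shows "(\<integral>\<^sup>+x. h x \<partial>M) = a * (\<integral>\<^sup>+x. h x \<partial>N) + b * (\<integral>\<^sup>+x. h x \<partial>N')"
proof -
  have bm: "(borel_measurable N :: (_ \<Rightarrow> ennreal) set) = borel_measurable M"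
    "(borel_measurable N' :: (_ \<Rightarrow> ennreal) set) = borel_measurable M"
    by (rule measurable_cong_sets[OF sets(1) refl], rule measurable_cong_sets[OF sets(2) refl])
  have sp: "space N = space M" "space N' = space M"
    using sets by (auto dest: sets_eq_imp_space_eq)
  show ?thesis using h
  proof (induction h rule: borel_measurable_induct)
    case (cong f g)
    have "(\<integral>\<^sup>+x. f x \<partial>M) = (\<integral>\<^sup>+x. g x \<partial>M)" "(\<integral>\<^sup>+x. f x \<partial>N) = (\<integral>\<^sup>+x. g x \<partial>N)"
      "(\<integral>\<^sup>+x. f x \<partial>N') = (\<integral>\<^sup>+x. g x \<partial>N')"
      using cong(3) sp by (auto intro!: nn_integral_cong)
    then show ?case using cong(4) by simp
  next
    case (set A)
    then show ?case using sets eq by simp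
  next
    case (mult u c)
    then have "u \<in> borel_measurable N" "u \<in> borel_measurable N'" using bm by simp_all
    then show ?case using mult by (simp add: nn_integral_cmult distrib_left mult.left_commute)
  next
    case (add u v)
    then have "u \<in> borel_measurable N" "u \<in> borel_measurable N'" "v \<in> borel_measurable N" "v \<in> borel_measurable N'"
      using bm by simp_all
    then show ?case using add by (simp add: nn_integral_add distrib_left ac_simps)
  next
    case (seq U)
    have lim: "(\<integral>\<^sup>+x. (SUP i. U i) x \<partial>K) = (SUP i. \<integral>\<^sup>+x. U i x \<partial>K)"
      if "(borel_measurable K :: (_ \<Rightarrow> ennreal) set) = borel_measurable M" for K
      unfolding SUP_apply
      by (rule nn_integral_monotone_convergence_SUP[OF seq.hyps(3)]) (simp only: that seq.hyps(1))
    have inc: "incseq (\<lambda>i. d * (\<integral>\<^sup>+x. U i x \<partial>K))" for K d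
      by (intro incseq_SucI mult_left_mono nn_integral_mono zero_le)
        (use incseq_SucD[OF seq.hyps(3)] in \<open>simp add: le_fun_def\<close>)
    show ?case
      unfolding lim[OF refl] lim[OF bm(1)] lim[OF bm(2)] seq.IH SUP_mult_left_ennreal
      by (rule ennreal_SUP_add[OF inc inc])
  qed
qed

locale spike_slab_model =
  fixes I :: "nat \<Rightarrow> 'k set" and g :: "nat \<Rightarrow> ('k \<Rightarrow> real) \<Rightarrow> real" and L\<^sub>0 G c :: real and n :: nat
  assumes fin[simp]: "finite (I j)" and ne: "I j \<noteq> {}"
    and slab: "slab_densities I L\<^sub>0 G g"
    and n: "1 \<le> n" and cG: "4 + G \<le> c" and G: "0 < G"
begin

abbreviation "\<Lambda> \<equiv> Lam I"
abbreviation "J \<equiv> J_max n"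
abbreviation "block \<equiv> block_law I g c n"
abbreviation "prior \<equiv> block_prior I g c n"
abbreviation "blocks \<equiv> Sigma {..J} I"

lemma blocks[simp]: "finite blocks" "blocks \<subseteq> \<Lambda>"
  by (auto simp: Lam_def)

lemma slab_facts:
  shows g_measurable[measurable]: "g j \<in> borel_measurable (\<Pi>\<^sub>M k\<in>I j. lborel)"
    and g_integral: "(\<integral>\<^sup>+x. ennreal (g j x) \<partial>(\<Pi>\<^sub>M k\<in>I j. lborel)) = 1"
    and g_le: "x \<in> (\<Pi>\<^sub>E k\<in>I j. UNIV) \<Longrightarrow> g j x \<le> exp (G * real (card (I j)))"
    and g_ge: "x \<in> (\<Pi>\<^sub>E k\<in>I j. {-L\<^sub>0..L\<^sub>0}) \<Longrightarrow> exp (- G * real (card (I j))) \<le> g j x"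
  using spec[OF slab[unfolded slab_densities_def], of j] by blast+

lemma sets_block[simp, measurable_cong]: "sets (block j) = sets (\<Pi>\<^sub>M k\<in>I j. borel)"
  unfolding block_law_def
  using sets.sigma_sets_eq[of "\<Pi>\<^sub>M k\<in>I j. borel"] sets.space_closed[of "\<Pi>\<^sub>M k\<in>I j. borel"]
  by (subst sets_measure_of) (auto simp: space_PiM)

lemma space_block[simp]: "space (block j) = (\<Pi>\<^sub>E k\<in>I j. UNIV)"
  using sets_eq_imp_space_eq[OF sets_block[of j]] by (simp add: space_PiM)

lemma zero_in_space: "(\<lambda>k\<in>I j. 0) \<in> space (\<Pi>\<^sub>M k\<in>I j. borel :: real measure)"
  by (simp add: space_PiM)

text \<open>The set function that defines the block law is a measure because it is a combination of a
  Dirac measure and a measure with a density.\<close>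

lemma emeasure_block:
  assumes "A \<in> sets (block j)"
  shows "emeasure (block j) A = ennreal (1 / (1 + slab_weight I c n j)) *
      (emeasure (return (\<Pi>\<^sub>M k\<in>I j. borel) (\<lambda>k\<in>I j. 0)) A
       + ennreal (slab_weight I c n j) * emeasure (density (\<Pi>\<^sub>M k\<in>I j. lborel) (\<lambda>x. ennreal (g j x))) A)"
    
proof -
  define z :: "'k \<Rightarrow> real" where "z = (\<lambda>k\<in>I j. 0)"
  let ?B = "\<Pi>\<^sub>M k\<in>I j. borel :: real measure" and ?N = "return (\<Pi>\<^sub>M k\<in>I j. borel) z"
    and ?N' = "density (\<Pi>\<^sub>M k\<in>I j. lborel) (\<lambda>x. ennreal (g j x))"
  let ?m = "\<lambda>A. ennreal (1 / (1 + slab_weight I c n j)) *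
          (indicator A z + ennreal (slab_weight I c n j) *
              (\<integral>\<^sup>+ x\<in>A. ennreal (g j x) \<partial>(\<Pi>\<^sub>M k\<in>I j. lborel)))"
  let ?m' = "\<lambda>A. ennreal (1 / (1 + slab_weight I c n j)) *
      (emeasure ?N A + ennreal (slab_weight I c n j) * emeasure ?N' A)"
  have sB: "sets (\<Pi>\<^sub>M k\<in>I j. lborel :: real measure) = sets ?B"
    by (rule sets_PiM_cong) auto
  have eq: "?m X = ?m' X" if "X \<in> sets ?B" for X
  proof -
    have "emeasure ?N X = indicator X z" using that by (rule emeasure_return)
    moreover have "emeasure ?N' X = (\<integral>\<^sup>+ x\<in>X. ennreal (g j x) \<partial>(\<Pi>\<^sub>M k\<in>I j. lborel))"
      by (rule emeasure_density) (simp_all only: that sB measurable_compose[OF g_measurable measurable_ennreal])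
    ultimately show ?thesis by (simp only:)
  qed
  have ca: "countably_additive (sets ?B) ?m'"
  proof (rule countably_additiveI)
    fix A :: "nat \<Rightarrow> _" assume A: "range A \<subseteq> sets ?B" "disjoint_family A"
    have "(\<Sum>i. ?m' (A i)) = ennreal (1 / (1 + slab_weight I c n j)) *
        ((\<Sum>i. emeasure ?N (A i)) + ennreal (slab_weight I c n j) * (\<Sum>i. emeasure ?N' (A i)))"
      by (simp add: suminf_add[symmetric])
    also have "(\<Sum>i. emeasure ?N (A i)) = emeasure ?N (\<Union>i. A i)"
      using A by (intro suminf_emeasure) auto
    also have "(\<Sum>i. emeasure ?N' (A i)) = emeasure ?N' (\<Union>i. A i)"
      using A by (intro suminf_emeasure) (auto simp: sB)
    finally show "(\<Sum>i. ?m' (A i)) = ?m' (\<Union>i. A i)" .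
  qed
  have "emeasure (block j) A = ?m A"
  proof (rule emeasure_measure_of[OF block_law_def[of I g c n j, folded z_def]])
    show "sets ?B \<subseteq> Pow (\<Pi>\<^sub>E k\<in>I j. UNIV)" using sets.space_closed[of ?B] by (simp add: space_PiM)
    show "positive (sets (block j)) ?m" by (simp add: positive_def)
    show "countably_additive (sets (block j)) ?m"
      using ca by (simp add: countably_additive_def eq subset_eq)
  qed fact
  then show ?thesis using eq assms unfolding z_def[symmetric] by simp
qed

lemma nn_integral_block:
  assumes h: "h \<in> borel_measurable (block j)"
  shows "(\<integral>\<^sup>+x. h x \<partial>block j) = ennreal (1 / (1 + slab_weight I c n j)) *
      (h (\<lambda>k\<in>I j. 0) + ennreal (slab_weight I c n j) * (\<integral>\<^sup>+x. ennreal (g j x) * h x \<partial>(\<Pi>\<^sub>M k\<in>I j. lborel)))"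
proof -
  let ?N = "return (\<Pi>\<^sub>M k\<in>I j. borel) (\<lambda>k\<in>I j. 0)" and ?N' = "density (\<Pi>\<^sub>M k\<in>I j. lborel) (\<lambda>x. ennreal (g j x))"
  let ?a = "ennreal (1 / (1 + slab_weight I c n j))" and ?\<nu> = "ennreal (slab_weight I c n j)"
  have sB: "sets (\<Pi>\<^sub>M k\<in>I j. lborel :: real measure) = sets (\<Pi>\<^sub>M k\<in>I j. borel)"
    by (rule sets_PiM_cong) auto
  have hB: "h \<in> borel_measurable (\<Pi>\<^sub>M k\<in>I j. borel)" "h \<in> borel_measurable (\<Pi>\<^sub>M k\<in>I j. lborel)"
    using h measurable_cong_sets[OF sets_block refl] measurable_cong_sets[OF sB refl] by blast+
  have "(\<integral>\<^sup>+x. h x \<partial>block j) = ?a * (\<integral>\<^sup>+x. h x \<partial>?N) + ?a * ?\<nu> * (\<integral>\<^sup>+x. h x \<partial>?N')"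
    by (rule nn_integral_mixture[OF _ _ _ h]) (simp_all add: emeasure_block sB distrib_left mult.assoc)
  also have "(\<integral>\<^sup>+x. h x \<partial>?N) = h (\<lambda>k\<in>I j. 0)"
    using zero_in_space hB(1) by (rule nn_integral_return)
  also have "(\<integral>\<^sup>+x. h x \<partial>?N') = (\<integral>\<^sup>+x. ennreal (g j x) * h x \<partial>(\<Pi>\<^sub>M k\<in>I j. lborel))"
    using hB(2) by (intro nn_integral_density) auto
  finally show ?thesis by (simp only: distrib_left mult.assoc)
qed

lemma slab_weight_nonneg: "0 \<le> slab_weight I c n j"
  by (simp add: slab_weight_def)

lemma prob_space_block: "prob_space (block j)"
proof (rule prob_spaceI)
  have "emeasure (block j) (space (block j)) = (\<integral>\<^sup>+x. 1 \<partial>block j)" by simp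
  also have "\<dots> = ennreal (1 / (1 + slab_weight I c n j)) * (1 + ennreal (slab_weight I c n j))"
    by (subst nn_integral_block) (simp_all add: g_integral)
  also have "\<dots> = ennreal (1 / (1 + slab_weight I c n j) * (1 + slab_weight I c n j))"
    using slab_weight_nonneg[of j] by (subst ennreal_mult) auto
  also have "\<dots> = 1" using slab_weight_nonneg[of j] by (simp add: add_nonneg_eq_0_iff)
  finally show "emeasure (block j) (space (block j)) = 1" .
qed

sublocale blk: product_prob_space block K for K
  by (intro product_prob_spaceI prob_space_block)

text \<open>The map that carries the product of the block laws to the prior.\<close>

definition embed :: "(nat \<Rightarrow> 'k \<Rightarrow> real) \<Rightarrow> (nat \<times> 'k \<Rightarrow> real)" where
  "embed x = (\<lambda>(j, k)\<in>Lam I. if j \<le> J then x j k else 0)"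

lemma embed_blocks: "j \<le> J \<Longrightarrow> k \<in> I j \<Longrightarrow> embed x (j, k) = x j k"
  by (simp add: embed_def Lam_def)

lemma embed_off_blocks: "i \<in> \<Lambda> - blocks \<Longrightarrow> embed x i = 0"
  by (auto simp: embed_def Lam_def split: if_splits)

lemma param_component[measurable]: "i \<in> \<Lambda> \<Longrightarrow> (\<lambda>\<theta>. \<theta> i) \<in> borel_measurable (param_space \<Lambda>)"
  unfolding param_space_def by (intro measurable_restrict_space1 measurable_component_singleton)

lemma embed_measurable[measurable]: "embed \<in> measurable (\<Pi>\<^sub>M j\<in>{..J}. block j) (param_space \<Lambda>)"
  unfolding param_space_def
proof (rule measurable_restrict_space2)
  have "(\<lambda>i. (embed x i)\<^sup>2) summable_on \<Lambda>" for x
  proof -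
    have "(\<lambda>i. (embed x i)\<^sup>2) summable_on blocks" by (rule summable_on_finite) simp
    then show ?thesis
      by (rule summable_on_cong_neutral[THEN iffD1, rotated -1]) (use embed_off_blocks in \<open>auto simp: Lam_def\<close>)
  qed
  then show "embed \<in> space (\<Pi>\<^sub>M j\<in>{..J}. block j) \<rightarrow> ell2 \<Lambda>"
    by (auto simp: ell2_def embed_def)
  show "embed \<in> measurable (\<Pi>\<^sub>M j\<in>{..J}. block j) (\<Pi>\<^sub>M i\<in>\<Lambda>. borel)"
    unfolding embed_def
  proof (rule measurable_restrict)
    fix i assume "i \<in> \<Lambda>"
    then obtain j k where i: "i = (j, k)" "k \<in> I j" by (auto simp: Lam_def)
    have "(\<lambda>x. x j k) \<in> borel_measurable (\<Pi>\<^sub>M j\<in>{..J}. block j)" if "j \<le> J"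
    proof (rule measurable_compose[where g="\<lambda>y. y k"])
      show "(\<lambda>x. x j) \<in> measurable (\<Pi>\<^sub>M j\<in>{..J}. block j) (block j)"
        using that by (intro measurable_component_singleton) simp
      show "(\<lambda>y. y k) \<in> borel_measurable (block j)"
        using i(2) by (subst measurable_cong_sets[OF sets_block refl]) (rule measurable_component_singleton)
    qed
    then show "(\<lambda>x. case i of (j, k) \<Rightarrow> if j \<le> J then x j k else 0) \<in> borel_measurable (\<Pi>\<^sub>M j\<in>{..J}. block j)"
      unfolding i prod.case by (cases "j \<le> J") (simp_all only: if_True if_False borel_measurable_const)
  qed
qed

lemma prior_eq: "prior = distr (\<Pi>\<^sub>M j\<in>{..J}. block j) (param_space \<Lambda>) embed"
  by (simp add: block_prior_def embed_def[abs_def])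

lemma sets_prior[simp, measurable_cong]: "sets prior = sets (param_space \<Lambda>)"
  by (simp add: prior_eq)

lemma prob_space_prior: "prob_space prior"
  unfolding prior_eq by (rule blk.prob_space_distr) measurable

lemma countable_index: "countable \<Lambda>"
  unfolding Lam_def by (intro countable_SIGMA) (auto intro: countable_finite)

lemma AE_prior_support: "AE \<theta> in prior. \<forall>i\<in>\<Lambda> - blocks. \<theta> i = 0"
proof -
  have "AE \<theta> in prior. \<theta> i = 0" if "i \<in> \<Lambda> - blocks" for i
  proof -
    have "{\<theta> \<in> space (param_space \<Lambda>). \<theta> i = 0} \<in> sets (param_space \<Lambda>)"
      using that by (intro borel_measurable_eq borel_measurable_const param_component) auto
    note AE_distr_iff[OF embed_measurable this]
    then show ?thesis unfolding prior_eq using embed_off_blocks[OF that] by simp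
  qed
  then show ?thesis
    using countable_Diff[OF countable_index] by (subst AE_ball_countable) auto
qed

lemma nn_integral_prior_prod:
  assumes [measurable]: "\<And>i. i \<in> blocks \<Longrightarrow> \<phi> i \<in> borel_measurable borel"
  shows "(\<integral>\<^sup>+\<theta>. (\<Prod>i\<in>blocks. \<phi> i (\<theta> i)) \<partial>prior) = (\<Prod>j\<le>J. \<integral>\<^sup>+x. (\<Prod>k\<in>I j. \<phi> (j, k) (x k)) \<partial>block j)"
proof -
  have m: "(\<lambda>\<theta>. \<Prod>i\<in>blocks. \<phi> i (\<theta> i)) \<in> borel_measurable (param_space \<Lambda>)"
  proof (intro borel_measurable_prod_ennreal)
    fix i assume i: "i \<in> blocks"
    then have "i \<in> \<Lambda>" using blocks(2) by blast
    then show "(\<lambda>\<theta>. \<phi> i (\<theta> i)) \<in> borel_measurable (param_space \<Lambda>)"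
      by (rule measurable_compose[OF param_component assms[OF i]])
  qed
  have mb: "(\<lambda>x. \<Prod>k\<in>I j. \<phi> (j, k) (x k)) \<in> borel_measurable (block j)" if "j \<le> J" for j
  proof (intro borel_measurable_prod_ennreal)
    fix k assume k: "k \<in> I j"
    have "(\<lambda>x. x k) \<in> borel_measurable (block j)"
      using k by (subst measurable_cong_sets[OF sets_block refl]) (rule measurable_component_singleton)
    then show "(\<lambda>x. \<phi> (j, k) (x k)) \<in> borel_measurable (block j)"
      by (rule measurable_compose) (use that k assms in auto)
  qed
  have "(\<integral>\<^sup>+\<theta>. (\<Prod>i\<in>blocks. \<phi> i (\<theta> i)) \<partial>prior)
    = (\<integral>\<^sup>+x. (\<Prod>i\<in>blocks. \<phi> i (embed x i)) \<partial>(\<Pi>\<^sub>M j\<in>{..J}. block j))"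
    unfolding prior_eq using m by (intro nn_integral_distr) simp_all
  also have "\<dots> = (\<integral>\<^sup>+x. (\<Prod>j\<le>J. \<Prod>k\<in>I j. \<phi> (j, k) (x j k)) \<partial>(\<Pi>\<^sub>M j\<in>{..J}. block j))"
  proof (intro nn_integral_cong)
    fix x
    have "(\<Prod>i\<in>blocks. \<phi> i (embed x i)) = (\<Prod>j\<le>J. \<Prod>k\<in>I j. \<phi> (j, k) (embed x (j, k)))"
      by (subst prod.Sigma) auto
    also have "\<dots> = (\<Prod>j\<le>J. \<Prod>k\<in>I j. \<phi> (j, k) (x j k))"
      by (intro prod.cong refl) (simp add: embed_blocks)
    finally show "(\<Prod>i\<in>blocks. \<phi> i (embed x i)) = (\<Prod>j\<le>J. \<Prod>k\<in>I j. \<phi> (j, k) (x j k))" .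
  qed
  also have "\<dots> = (\<Prod>j\<le>J. \<integral>\<^sup>+x. (\<Prod>k\<in>I j. \<phi> (j, k) (x k)) \<partial>block j)"
    by (rule blk.product_nn_integral_prod) (use mb in auto)
  finally show ?thesis .
qed

end

section \<open>Bayes' formula and the posterior mass of a set\<close>

text \<open>A probability bounded by \<open>w ^ 4\<close> is bounded by \<open>w\<close>, which turns a
  bound without expectation into an integrable one.\<close>

lemma le_of_le_power4:
  fixes t w :: real
  assumes "0 \<le> w" "t \<le> 1" "t \<le> w ^ 4"
  shows "t \<le> w"
proof (rule ccontr)
  assume "\<not> t \<le> w"
  then have "w < t" by simp
  then have "w ^ 4 < t ^ 4" using assms(1) by (intro power_strict_mono) auto
  also have "t ^ 4 \<le> t" using assms \<open>w < t\<close> power_decreasing[of 1 4 t] by simp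
  finally show False using assms(3) by simp
qed

context spike_slab_model
begin

abbreviation "noise_only \<equiv> white_noise \<Lambda> n (\<lambda>_. 0)"

definition joint_lik :: "(nat \<times> 'k \<Rightarrow> real) \<Rightarrow> (nat \<times> 'k \<Rightarrow> real) \<Rightarrow> ennreal" where
  "joint_lik \<theta> y = ennreal (\<Prod>i\<in>blocks. lik n (y i) (\<theta> i))"

definition evidence :: "(nat \<times> 'k \<Rightarrow> real) \<Rightarrow> ennreal" where
  "evidence y = (\<integral>\<^sup>+\<theta>. joint_lik \<theta> y \<partial>prior)"

lemma joint_lik_measurable: "(\<lambda>p. joint_lik (fst p) (snd p)) \<in> borel_measurable (prior \<Otimes>\<^sub>M noise_only)"
  unfolding joint_lik_def
proof (intro measurable_compose[OF _ measurable_ennreal] borel_measurable_prod lik_measurable)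
  fix i assume "i \<in> blocks"
  then have i: "i \<in> \<Lambda>" using blocks(2) by blast
  have "fst \<in> measurable (prior \<Otimes>\<^sub>M noise_only) (param_space \<Lambda>)"
    using measurable_fst measurable_cong_sets[OF refl sets_prior] by blast
  then show "(\<lambda>p. fst p i) \<in> borel_measurable (prior \<Otimes>\<^sub>M noise_only)"
    by (rule measurable_compose[OF _ param_component[OF i]])
  have "snd \<in> measurable (prior \<Otimes>\<^sub>M noise_only) (obs_space \<Lambda>)"
    using measurable_snd measurable_cong_sets[OF refl sets_white_noise] by blast
  then show "(\<lambda>p. snd p i) \<in> borel_measurable (prior \<Otimes>\<^sub>M noise_only)"
    by (rule measurable_compose[OF _ obs_component[OF i]])
qed

lemma joint_lik_measurable_obs: "joint_lik \<theta> \<in> borel_measurable (obs_space \<Lambda>)"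
  using lik_prod_measurable'[OF blocks(2)] unfolding joint_lik_def measurable_white_noise_eq .

lemma joint_lik_measurable_param: "(\<lambda>\<theta>. joint_lik \<theta> y) \<in> borel_measurable prior"
  unfolding joint_lik_def
proof (intro measurable_compose[OF _ measurable_ennreal] borel_measurable_prod lik_measurable borel_measurable_const)
  fix i assume "i \<in> blocks"
  then have i: "i \<in> \<Lambda>" using blocks(2) by blast
  show "(\<lambda>\<theta>. \<theta> i) \<in> borel_measurable prior"
    using param_component[OF i] measurable_cong_sets[OF sets_prior refl] by blast
qed

lemma nn_integral_white_noise_supported:
  assumes "\<forall>i\<in>\<Lambda> - blocks. \<theta> i = 0" and u: "u \<in> borel_measurable (obs_space \<Lambda>)"
  shows "(\<integral>\<^sup>+y. u y \<partial>white_noise \<Lambda> n \<theta>) = (\<integral>\<^sup>+y. joint_lik \<theta> y * u y \<partial>noise_only)"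
proof -
  have "white_noise \<Lambda> n \<theta> = density noise_only (joint_lik \<theta>)"
    unfolding joint_lik_def using assms n by (intro white_noise_density[OF blocks]) auto
  then show ?thesis
    using joint_lik_measurable_obs[of \<theta>] u by (simp only:) (intro nn_integral_density, simp_all)
qed

text \<open>Exchanging the roles of parameter and data in the joint law. All the laws
  \<open>P\<^sub>\<theta>\<close> with \<open>\<theta>\<close> in the support of the prior have
  densities with respect to the pure noise law, so that Fubini's theorem applies.\<close>

lemma bayes_fubini:
  assumes u: "u \<in> borel_measurable (obs_space \<Lambda>)" and A: "A \<in> sets (param_space \<Lambda>)"
  shows "(\<integral>\<^sup>+\<theta>. (\<integral>\<^sup>+y. u y \<partial>white_noise \<Lambda> n \<theta>) * indicator A \<theta> \<partial>prior)
    = (\<integral>\<^sup>+y. u y * (\<integral>\<^sup>+\<theta>. joint_lik \<theta> y * indicator A \<theta> \<partial>prior) \<partial>noise_only)"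
proof -
  interpret prior: prob_space prior by (rule prob_space_prior)
  interpret Q: prob_space noise_only by (rule prob_space_white_noise)
  interpret pair_sigma_finite prior noise_only ..
  have uQ: "u \<in> borel_measurable noise_only" using u by simp
  have A': "indicator A \<in> borel_measurable prior" using A by simp
  have "(\<integral>\<^sup>+\<theta>. (\<integral>\<^sup>+y. u y \<partial>white_noise \<Lambda> n \<theta>) * indicator A \<theta> \<partial>prior)
    = (\<integral>\<^sup>+\<theta>. (\<integral>\<^sup>+y. u y * (joint_lik \<theta> y * indicator A \<theta>) \<partial>noise_only) \<partial>prior)"
  proof (rule nn_integral_cong_AE)
    have eq: "(\<integral>\<^sup>+y. u y \<partial>white_noise \<Lambda> n \<theta>) * indicator A \<theta> = (\<integral>\<^sup>+y. u y * (joint_lik \<theta> y * indicator A \<theta>) \<partial>noise_only)"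
      if "\<forall>i\<in>\<Lambda> - blocks. \<theta> i = 0" for \<theta>
    proof -
      have "(\<lambda>y. joint_lik \<theta> y * u y) \<in> borel_measurable noise_only"
        using joint_lik_measurable_obs[of \<theta>] u by simp
      then show ?thesis
        unfolding nn_integral_white_noise_supported[OF that u]
        by (subst nn_integral_multc[symmetric]) (simp_all only: mult_ac)
    qed
    show "AE \<theta> in prior. (\<integral>\<^sup>+y. u y \<partial>white_noise \<Lambda> n \<theta>) * indicator A \<theta>
        = (\<integral>\<^sup>+y. u y * (joint_lik \<theta> y * indicator A \<theta>) \<partial>noise_only)"
      by (rule eventually_mono[OF AE_prior_support]) (rule eq)
  qed
  also have "\<dots> = (\<integral>\<^sup>+y. (\<integral>\<^sup>+\<theta>. u y * (joint_lik \<theta> y * indicator A \<theta>) \<partial>prior) \<partial>noise_only)"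
  proof (rule Fubini'[symmetric])
    have "(\<lambda>p. u (snd p) * (joint_lik (fst p) (snd p) * indicator A (fst p))) \<in> borel_measurable (prior \<Otimes>\<^sub>M noise_only)"
      by (intro borel_measurable_times_ennreal joint_lik_measurable measurable_compose[OF measurable_snd uQ]
          measurable_compose[OF measurable_fst A'])
    then show "(\<lambda>(\<theta>, y). u y * (joint_lik \<theta> y * indicator A \<theta>)) \<in> borel_measurable (prior \<Otimes>\<^sub>M noise_only)"
      by (simp only: split_beta')
  qed
  also have "\<dots> = (\<integral>\<^sup>+y. u y * (\<integral>\<^sup>+\<theta>. joint_lik \<theta> y * indicator A \<theta> \<partial>prior) \<partial>noise_only)"
    by (intro nn_integral_cong nn_integral_cmult borel_measurable_times_ennreal joint_lik_measurable_param A')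
  finally show ?thesis .
qed

text \<open>Bayes' formula, for an arbitrary version of the posterior.\<close>

lemma posterior_formula:
  assumes post: "is_posterior prior (obs_space \<Lambda>) (white_noise \<Lambda> n) \<kappa>" and A: "A \<in> sets (param_space \<Lambda>)"
  shows "AE y in noise_only. (\<integral>\<^sup>+\<theta>. joint_lik \<theta> y * indicator A \<theta> \<partial>prior) = emeasure (\<kappa> y) A * evidence y"
proof -
  interpret prior: prob_space prior by (rule prob_space_prior)
  interpret Q: prob_space noise_only by (rule prob_space_white_noise)
  have kA: "(\<lambda>y. emeasure (\<kappa> y) A) \<in> borel_measurable (obs_space \<Lambda>)"
    using post A measurable_emeasure_kernel[OF measurable_prob_algebraD, of \<kappa> "obs_space \<Lambda>" prior A]
    by (simp add: is_posterior_def)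
  have meas: "(\<lambda>y. \<integral>\<^sup>+\<theta>. joint_lik \<theta> y * indicator A' \<theta> \<partial>prior) \<in> borel_measurable noise_only"
    if A': "A' \<in> sets (param_space \<Lambda>)" for A'
  proof (rule prior.borel_measurable_nn_integral)
    have ind: "indicator A' \<in> borel_measurable prior" using A' by simp
    have "(\<lambda>p. joint_lik (fst p) (snd p) * indicator A' (fst p)) \<in> borel_measurable (prior \<Otimes>\<^sub>M noise_only)"
      by (intro borel_measurable_times_ennreal joint_lik_measurable measurable_compose[OF measurable_fst ind])
    from measurable_pair_swap[OF this]
    show "(\<lambda>(y, \<theta>). joint_lik \<theta> y * indicator A' \<theta>) \<in> borel_measurable (noise_only \<Otimes>\<^sub>M prior)"
      by (simp add: split_beta')
  qed
  have sp: "space (param_space \<Lambda>) \<in> sets (param_space \<Lambda>)" by simp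
  have space_eq: "space prior = space (param_space \<Lambda>)" by (rule sets_eq_imp_space_eq) simp
  have ev: "(\<integral>\<^sup>+\<theta>. joint_lik \<theta> y * indicator (space (param_space \<Lambda>)) \<theta> \<partial>prior) = evidence y" for y
    unfolding evidence_def by (intro nn_integral_cong) (simp add: space_eq)
  have ev_meas: "evidence \<in> borel_measurable noise_only" using meas[OF sp] unfolding ev .
  let ?F = "\<lambda>y. \<integral>\<^sup>+\<theta>. joint_lik \<theta> y * indicator A \<theta> \<partial>prior" and ?F' = "\<lambda>y. emeasure (\<kappa> y) A * evidence y"
  have F'_meas: "?F' \<in> borel_measurable noise_only"
    using kA ev_meas by (intro borel_measurable_times_ennreal) simp_all
  have "density noise_only ?F = density noise_only ?F'"
  proof (rule measure_eqI)
    fix B assume "B \<in> sets (density noise_only ?F)"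
    then have B: "B \<in> sets (obs_space \<Lambda>)" by simp
    then have BQ: "B \<in> sets noise_only" by simp
    have iB: "indicator B \<in> borel_measurable (obs_space \<Lambda>)" using B by simp
    have "emeasure (density noise_only ?F) B = (\<integral>\<^sup>+y. indicator B y * ?F y \<partial>noise_only)"
      by (subst emeasure_density[OF meas[OF A] BQ]) (intro nn_integral_cong mult.commute)
    also have "\<dots> = (\<integral>\<^sup>+\<theta>. (\<integral>\<^sup>+y. indicator B y \<partial>white_noise \<Lambda> n \<theta>) * indicator A \<theta> \<partial>prior)"
      by (rule bayes_fubini[OF iB A, symmetric])
    also have "\<dots> = (\<integral>\<^sup>+\<theta>. emeasure (white_noise \<Lambda> n \<theta>) B * indicator A \<theta> \<partial>prior)"
      using B by simp
    also have "\<dots> = (\<integral>\<^sup>+\<theta>. (\<integral>\<^sup>+y. emeasure (\<kappa> y) A * indicator B y \<partial>white_noise \<Lambda> n \<theta>) \<partial>prior)"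
      using post A B by (simp add: is_posterior_def)
    also have "\<dots> = (\<integral>\<^sup>+\<theta>. (\<integral>\<^sup>+y. emeasure (\<kappa> y) A * indicator B y \<partial>white_noise \<Lambda> n \<theta>) *
        indicator (space (param_space \<Lambda>)) \<theta> \<partial>prior)"
      by (intro nn_integral_cong) (simp add: space_eq)
    also have "\<dots> = (\<integral>\<^sup>+y. (emeasure (\<kappa> y) A * indicator B y) * evidence y \<partial>noise_only)"
      unfolding ev[symmetric] by (rule bayes_fubini[OF borel_measurable_times_ennreal[OF kA iB] sp])
    also have "\<dots> = emeasure (density noise_only ?F') B"
      by (subst emeasure_density[OF F'_meas BQ], intro nn_integral_cong) (simp only: mult_ac)
    finally show "emeasure (density noise_only ?F) B = emeasure (density noise_only ?F') B" .
  qed simp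
  then show ?thesis by (rule Q.density_unique[OF meas[OF A] F'_meas])
qed

lemma evidence_pos: "evidence y \<noteq> 0"
proof
  interpret prior: prob_space prior by (rule prob_space_prior)
  assume "evidence y = 0"
  then have "AE \<theta> in prior. joint_lik \<theta> y = 0"
    unfolding evidence_def using nn_integral_0_iff_AE[OF joint_lik_measurable_param] by blast
  moreover have "joint_lik \<theta> y \<noteq> 0" for \<theta>
    unfolding joint_lik_def ennreal_eq_0_iff not_le by (intro prod_pos) simp
  ultimately have "AE \<theta> in prior. False" by simp
  then show False unfolding prior.AE_False .
qed

lemma evidence_finite: "evidence y \<noteq> \<top>"
proof -
  interpret prior: prob_space prior by (rule prob_space_prior)
  have le: "lik n (y i) x \<le> exp (n * (y i)\<^sup>2 / 2)" for i x
  proof -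
    have "0 \<le> real n * (y i - x)\<^sup>2" by simp
    then show ?thesis by (simp add: lik_def power2_eq_square algebra_simps)
  qed
  have "evidence y \<le> (\<integral>\<^sup>+\<theta>. ennreal (\<Prod>i\<in>blocks. exp (n * (y i)\<^sup>2 / 2)) \<partial>prior)"
    unfolding evidence_def joint_lik_def by (intro nn_integral_mono ennreal_leI prod_mono) (use le in auto)
  also have "\<dots> < \<top>" by (simp add: prior.emeasure_space_1 ennreal_less_top)
  finally show ?thesis by simp
qed

text \<open>The predicate \<open>rough\<close> selects the levels that use the first of the two bounds.
  It stays arbitrary until the sums over the levels are estimated.\<close>

definition block_bound :: "(nat \<times> 'k \<Rightarrow> real) \<Rightarrow> (nat \<Rightarrow> bool) \<Rightarrow> nat \<Rightarrow> real \<Rightarrow> real" where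
  "block_bound \<theta>\<^sub>0 rough j Z =
     (if rough j then block_bound_rough (c + G) (card (I j)) Z
      else block_bound_smooth (\<Sum>k\<in>I j. real n * (\<theta>\<^sub>0 (j, k))\<^sup>2) (card (I j)) Z)"

lemma block_bound_nonneg: "0 \<le> block_bound \<theta>\<^sub>0 rough j Z"
  by (simp add: block_bound_def block_bound_rough_def block_bound_smooth_def)

lemma lik_tilt_measurable: "(\<lambda>x. ennreal (exp (real n * (x - t)\<^sup>2 / 16) * lik n y x)) \<in> borel_measurable borel"
  "(\<lambda>x. ennreal (lik n y x)) \<in> borel_measurable borel"
  by measurable

text \<open>Prior and likelihood factorise over the levels, which reduces the claim to one
  block.\<close>

lemma tilted_evidence_le:
  fixes \<theta>\<^sub>0 y :: "nat \<times> 'k \<Rightarrow> real"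
  assumes \<theta>\<^sub>0: "\<And>i. i \<in> blocks \<Longrightarrow> \<bar>\<theta>\<^sub>0 i\<bar> \<le> L\<^sub>0 - 1"
  shows "(\<integral>\<^sup>+\<theta>. ennreal (exp ((\<Sum>i\<in>blocks. real n * (\<theta> i - \<theta>\<^sub>0 i)\<^sup>2) / 16)) * joint_lik \<theta> y \<partial>prior)
    \<le> ennreal ((\<Prod>j\<le>J. block_bound \<theta>\<^sub>0 rough j (\<Sum>k\<in>I j. real n * (y (j, k) - \<theta>\<^sub>0 (j, k))\<^sup>2)) ^ 4) * evidence y"
proof -
  let ?w = "\<lambda>i (x::real). exp (real n * (x - \<theta>\<^sub>0 i)\<^sup>2 / 16) * lik n (y i) x"
  let ?V = "\<lambda>j. block_bound \<theta>\<^sub>0 rough j (\<Sum>k\<in>I j. real n * (y (j, k) - \<theta>\<^sub>0 (j, k))\<^sup>2)"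
  have comp: "(\<lambda>x. x k) \<in> borel_measurable (block j)" if "k \<in> I j" for j k
    using that by (subst measurable_cong_sets[OF sets_block refl]) (rule measurable_component_singleton)
  have "(\<integral>\<^sup>+\<theta>. ennreal (exp ((\<Sum>i\<in>blocks. real n * (\<theta> i - \<theta>\<^sub>0 i)\<^sup>2) / 16)) * joint_lik \<theta> y \<partial>prior)
    = (\<integral>\<^sup>+\<theta>. (\<Prod>i\<in>blocks. ennreal (?w i (\<theta> i))) \<partial>prior)"
    unfolding joint_lik_def
    by (intro nn_integral_cong) (simp add: prod_ennreal prod.distrib exp_sum sum_divide_distrib ennreal_mult' prod_nonneg)
  also have "\<dots> = (\<Prod>j\<le>J. \<integral>\<^sup>+x. (\<Prod>k\<in>I j. ennreal (?w (j, k) (x k))) \<partial>block j)"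
    by (rule nn_integral_prior_prod) (rule lik_tilt_measurable)
  also have "\<dots> \<le> (\<Prod>j\<le>J. ennreal (?V j ^ 4) * (\<integral>\<^sup>+x. (\<Prod>k\<in>I j. ennreal (lik n (y (j, k)) (x k))) \<partial>block j))"
  proof (intro prod_mono_ennreal)
    fix j assume j: "j \<in> {..J}"
    let ?a = "ennreal (1 / (1 + slab_weight I c n j))" and ?\<nu> = "ennreal (slab_weight I c n j)"
    have m: "(\<lambda>x. ennreal (\<Prod>k\<in>I j. ?w (j, k) (x k))) \<in> borel_measurable (block j)"
      "(\<lambda>x. ennreal (\<Prod>k\<in>I j. lik n (y (j, k)) (x k))) \<in> borel_measurable (block j)"
    proof -
      have "(\<lambda>x. \<Prod>k\<in>I j. ennreal (?w (j, k) (x k))) \<in> borel_measurable (block j)"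
        by (intro borel_measurable_prod_ennreal measurable_compose[OF comp lik_tilt_measurable(1)])
      then show "(\<lambda>x. ennreal (\<Prod>k\<in>I j. ?w (j, k) (x k))) \<in> borel_measurable (block j)"
        by (simp only: prod_ennreal mult_nonneg_nonneg exp_ge_zero lik_pos)
      have "(\<lambda>x. \<Prod>k\<in>I j. ennreal (lik n (y (j, k)) (x k))) \<in> borel_measurable (block j)"
        by (intro borel_measurable_prod_ennreal measurable_compose[OF comp lik_tilt_measurable(2)])
      then show "(\<lambda>x. ennreal (\<Prod>k\<in>I j. lik n (y (j, k)) (x k))) \<in> borel_measurable (block j)"
        by (simp only: prod_ennreal lik_pos)
    qed
    have at0: "(\<Prod>k\<in>I j. ?w (j, k) ((\<lambda>k\<in>I j. 0) k)) = (\<Prod>k\<in>I j. exp (real n * (\<theta>\<^sub>0 (j, k))\<^sup>2 / 16))"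
      "(\<Prod>k\<in>I j. lik n (y (j, k)) ((\<lambda>k\<in>I j. 0) k)) = 1"
      by (auto intro!: prod.cong)
    have "(\<integral>\<^sup>+x. (\<Prod>k\<in>I j. ennreal (?w (j, k) (x k))) \<partial>block j)
        = (\<integral>\<^sup>+x. ennreal (\<Prod>k\<in>I j. ?w (j, k) (x k)) \<partial>block j)"
      by (simp only: prod_ennreal mult_nonneg_nonneg exp_ge_zero lik_pos)
    also have "\<dots> = ?a * (ennreal (\<Prod>k\<in>I j. exp (real n * (\<theta>\<^sub>0 (j, k))\<^sup>2 / 16)) + ?\<nu> *
        (\<integral>\<^sup>+x. ennreal (g j x) * ennreal (\<Prod>k\<in>I j. ?w (j, k) (x k)) \<partial>(\<Pi>\<^sub>M k\<in>I j. lborel)))"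
      unfolding nn_integral_block[OF m(1)] at0 ..
    also have "\<dots> \<le> ?a * (ennreal (?V j ^ 4) * (1 + ?\<nu> *
        (\<integral>\<^sup>+x. ennreal (g j x) * ennreal (\<Prod>k\<in>I j. lik n (y (j, k)) (x k)) \<partial>(\<Pi>\<^sub>M k\<in>I j. lborel))))"
      unfolding slab_weight_def
    proof (intro mult_left_mono zero_le block_ratio_bound[OF fin ne _ cG G g_measurable g_le g_ge])
      show "1 \<le> real n" using n by simp
      show "\<bar>\<theta>\<^sub>0 (j, k)\<bar> \<le> L\<^sub>0 - 1" if "k \<in> I j" for k using \<theta>\<^sub>0 j that by simp
      show "?V j = block_bound_rough (c + G) (card (I j)) (\<Sum>k\<in>I j. real n * (y (j, k) - \<theta>\<^sub>0 (j, k))\<^sup>2) \<or>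
        ?V j = block_bound_smooth (\<Sum>k\<in>I j. real n * (\<theta>\<^sub>0 (j, k))\<^sup>2) (card (I j)) (\<Sum>k\<in>I j. real n * (y (j, k) - \<theta>\<^sub>0 (j, k))\<^sup>2)"
        by (simp add: block_bound_def)
    qed
    also have "\<dots> = ennreal (?V j ^ 4) * (\<integral>\<^sup>+x. ennreal (\<Prod>k\<in>I j. lik n (y (j, k)) (x k)) \<partial>block j)"
      unfolding nn_integral_block[OF m(2)] at0 by (simp only: ennreal_1 mult.left_commute)
    also have "\<dots> = ennreal (?V j ^ 4) * (\<integral>\<^sup>+x. (\<Prod>k\<in>I j. ennreal (lik n (y (j, k)) (x k))) \<partial>block j)"
      by (simp only: prod_ennreal lik_pos)
    finally show "(\<integral>\<^sup>+x. (\<Prod>k\<in>I j. ennreal (?w (j, k) (x k))) \<partial>block j)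
      \<le> ennreal (?V j ^ 4) * (\<integral>\<^sup>+x. (\<Prod>k\<in>I j. ennreal (lik n (y (j, k)) (x k))) \<partial>block j)" .
  qed
  also have "\<dots> = ennreal ((\<Prod>j\<le>J. ?V j) ^ 4) * (\<Prod>j\<le>J. \<integral>\<^sup>+x. (\<Prod>k\<in>I j. ennreal (lik n (y (j, k)) (x k))) \<partial>block j)"
    by (simp only: prod.distrib prod_ennreal block_bound_nonneg zero_le_power prod_power_distrib)
  also have "(\<Prod>j\<le>J. \<integral>\<^sup>+x. (\<Prod>k\<in>I j. ennreal (lik n (y (j, k)) (x k))) \<partial>block j) = evidence y"
    unfolding evidence_def joint_lik_def
    by (subst nn_integral_prior_prod[symmetric]) (simp_all only: lik_tilt_measurable prod_ennreal lik_pos)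
  finally show ?thesis .
qed

section \<open>Expected posterior mass\<close>

text \<open>Markov's inequality under the posterior, followed by the fourth root. The hypothesis
  \<open>far\<close> concerns the support of the prior, where only the coordinates in
  \<open>blocks\<close> vary.\<close>

lemma posterior_bound:
  fixes \<theta>\<^sub>0 :: "nat \<times> 'k \<Rightarrow> real" and x :: real
  assumes post: "is_posterior prior (obs_space \<Lambda>) (white_noise \<Lambda> n) \<kappa>" and A: "A \<in> sets (param_space \<Lambda>)"
    and \<theta>\<^sub>0: "\<And>i. i \<in> blocks \<Longrightarrow> \<bar>\<theta>\<^sub>0 i\<bar> \<le> L\<^sub>0 - 1"
    and far: "\<And>\<theta>. \<theta> \<in> A \<Longrightarrow> \<forall>i\<in>\<Lambda> - blocks. \<theta> i = 0 \<Longrightarrow> x \<le> (\<Sum>i\<in>blocks. real n * (\<theta> i - \<theta>\<^sub>0 i)\<^sup>2)"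
  shows "AE y in noise_only. emeasure (\<kappa> y) A \<le>
    ennreal (exp (- x / 64) * (\<Prod>j\<le>J. block_bound \<theta>\<^sub>0 rough j (\<Sum>k\<in>I j. real n * (y (j, k) - \<theta>\<^sub>0 (j, k))\<^sup>2)))"
    (is "AE y in _. _ \<le> ennreal (_ * ?V y)")
  using posterior_formula[OF post A] AE_space
proof eventually_elim
  case (elim y)
  let ?S = "\<lambda>\<theta>. \<Sum>i\<in>blocks. real n * (\<theta> i - \<theta>\<^sub>0 i)\<^sup>2"
  have V0: "0 \<le> ?V y" by (intro prod_nonneg) (simp add: block_bound_nonneg)
  have "\<kappa> y \<in> space (prob_algebra prior)"
    using post elim(2) measurable_space[of \<kappa> "obs_space \<Lambda>" "prob_algebra prior" y] by (simp add: is_posterior_def)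
  then interpret K: prob_space "\<kappa> y" by (simp add: space_prob_algebra)
  have tilt: "(\<lambda>\<theta>. ennreal (exp (?S \<theta> / 16)) * joint_lik \<theta> y) \<in> borel_measurable prior"
  proof (intro borel_measurable_times_ennreal joint_lik_measurable_param)
    have "(\<lambda>\<theta>. \<theta> i) \<in> borel_measurable prior" if "i \<in> blocks" for i
      using param_component[of i] blocks(2) that measurable_cong_sets[OF sets_prior refl] by blast
    then have "?S \<in> borel_measurable prior"
      by (intro borel_measurable_sum borel_measurable_times borel_measurable_power borel_measurable_diff borel_measurable_const)
    then show "(\<lambda>\<theta>. ennreal (exp (?S \<theta> / 16))) \<in> borel_measurable prior" by measurable
  qed
  have "emeasure (\<kappa> y) A * evidence y = (\<integral>\<^sup>+\<theta>. joint_lik \<theta> y * indicator A \<theta> \<partial>prior)"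
    using elim(1) by simp
  also have "\<dots> \<le> (\<integral>\<^sup>+\<theta>. ennreal (exp (- x / 16)) * (ennreal (exp (?S \<theta> / 16)) * joint_lik \<theta> y) \<partial>prior)"
  proof (rule nn_integral_mono_AE, rule eventually_mono[OF AE_prior_support])
    fix \<theta> :: "nat \<times> 'k \<Rightarrow> real" assume supp: "\<forall>i\<in>\<Lambda> - blocks. \<theta> i = 0"
    show "joint_lik \<theta> y * indicator A \<theta> \<le> ennreal (exp (- x / 16)) * (ennreal (exp (?S \<theta> / 16)) * joint_lik \<theta> y)"
    proof (cases "\<theta> \<in> A")
      case True
      have "x \<le> ?S \<theta>" by (rule far[OF True supp])
      then have "1 \<le> exp (- x / 16) * exp (?S \<theta> / 16)" by (simp add: exp_add[symmetric])
      then have "ennreal 1 \<le> ennreal (exp (- x / 16)) * ennreal (exp (?S \<theta> / 16))"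
        by (simp only: ennreal_mult'[symmetric] exp_ge_zero ennreal_leI)
      then have "1 * joint_lik \<theta> y \<le> ennreal (exp (- x / 16)) * ennreal (exp (?S \<theta> / 16)) * joint_lik \<theta> y"
        by (intro mult_right_mono) simp_all
      then show ?thesis using True by (simp add: mult.assoc)
    qed simp
  qed
  also have "\<dots> = ennreal (exp (- x / 16)) * (\<integral>\<^sup>+\<theta>. ennreal (exp (?S \<theta> / 16)) * joint_lik \<theta> y \<partial>prior)"
    by (rule nn_integral_cmult[OF tilt])
  also have "\<dots> \<le> ennreal (exp (- x / 16)) * (ennreal (?V y ^ 4) * evidence y)"
    by (intro mult_left_mono tilted_evidence_le \<theta>\<^sub>0) simp_all
  also have "\<dots> = ennreal ((exp (- x / 64) * ?V y) ^ 4) * evidence y"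
  proof -
    have "(exp (- x / 64) * ?V y) ^ 4 = exp (- x / 16) * ?V y ^ 4"
      by (simp add: power_mult_distrib exp_of_nat_mult[symmetric])
    then show ?thesis by (simp only: ennreal_mult'[OF exp_ge_zero] mult.assoc)
  qed
  finally have "evidence y * emeasure (\<kappa> y) A \<le> evidence y * ennreal ((exp (- x / 64) * ?V y) ^ 4)"
    by (simp only: mult.commute[of "evidence y"])
  then have "emeasure (\<kappa> y) A \<le> ennreal ((exp (- x / 64) * ?V y) ^ 4)"
    using ennreal_mult_le_mult_iff[OF evidence_pos evidence_finite] by blast
  then have "measure (\<kappa> y) A \<le> (exp (- x / 64) * ?V y) ^ 4"
    using V0 unfolding K.emeasure_eq_measure by (subst (asm) ennreal_le_iff) simp_all
  then have "measure (\<kappa> y) A \<le> exp (- x / 64) * ?V y"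
    by (rule le_of_le_power4[OF mult_nonneg_nonneg[OF exp_ge_zero V0] K.prob_le_1])
  then show ?case unfolding K.emeasure_eq_measure by (rule ennreal_leI)
qed

text \<open>The expectation of \<open>block_bound\<close> under the noise.\<close>

definition mean_block_bound :: "(nat \<times> 'k \<Rightarrow> real) \<Rightarrow> (nat \<Rightarrow> bool) \<Rightarrow> nat \<Rightarrow> real" where
  "mean_block_bound \<theta>\<^sub>0 rough j =
     (if rough j then exp (c + G) ^ card (I j) * (4 / sqrt 7) ^ card (I j)
      else exp ((\<Sum>k\<in>I j. real n * (\<theta>\<^sub>0 (j, k))\<^sup>2) / 4) * (1 + (3/5) ^ card (I j) * (4 / sqrt 7) ^ card (I j)))"

lemma noise_block_moment:
  "(\<integral>\<^sup>+\<epsilon>. ennreal (exp (9 / 32 * (\<Sum>k\<in>I j. (\<epsilon> (j, k))\<^sup>2))) \<partial>noise \<Lambda>) = ennreal ((4 / sqrt 7) ^ card (I j))"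
proof -
  have K: "finite ({j} \<times> I j)" "{j} \<times> I j \<subseteq> \<Lambda>" by (auto simp: Lam_def)
  have "exp (9 / 32 * (\<Sum>k\<in>I j. (\<epsilon> (j, k))\<^sup>2)) = (\<Prod>i\<in>{j} \<times> I j. exp (9 / 32 * (\<epsilon> i)\<^sup>2))" for \<epsilon> :: "nat \<times> 'k \<Rightarrow> real"
  proof -
    have "(\<Prod>i\<in>{j} \<times> I j. exp (9 / 32 * (\<epsilon> i)\<^sup>2)) = (\<Prod>k\<in>I j. exp (9 / 32 * (\<epsilon> (j, k))\<^sup>2))"
      by (subst prod.cartesian_product[symmetric, of "\<lambda>j k. exp (9 / 32 * (\<epsilon> (j, k))\<^sup>2)", simplified split_beta' prod.collapse]) simp
    then show ?thesis by (simp add: exp_sum sum_distrib_left)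
  qed
  then have "(\<integral>\<^sup>+\<epsilon>. ennreal (exp (9 / 32 * (\<Sum>k\<in>I j. (\<epsilon> (j, k))\<^sup>2))) \<partial>noise \<Lambda>)
    = (\<integral>\<^sup>+\<epsilon>. (\<Prod>i\<in>{j} \<times> I j. ennreal (exp (9 / 32 * (\<epsilon> i)\<^sup>2))) \<partial>noise \<Lambda>)"
    by (simp only: prod_ennreal exp_ge_zero)
  also have "\<dots> = (\<Prod>i\<in>{j} \<times> I j. \<integral>\<^sup>+z. ennreal (exp (9 / 32 * z\<^sup>2)) \<partial>std_normal)"
    by (rule noise.nn_integral_PiM_prod[OF K]) simp
  also have "\<dots> = ennreal ((4 / sqrt 7) ^ card (I j))"
    by (simp only: std_normal_exp_square prod_constant card_cartesian_product_singleton) (simp add: ennreal_power)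
  finally show ?thesis .
qed

lemma mean_block_bound_correct:
  "(\<integral>\<^sup>+\<epsilon>. ennreal (block_bound \<theta>\<^sub>0 rough j (\<Sum>k\<in>I j. (\<epsilon> (j, k))\<^sup>2)) \<partial>noise \<Lambda>)
    = ennreal (mean_block_bound \<theta>\<^sub>0 rough j)"
proof -
  let ?W = "\<lambda>\<epsilon>. exp (9 / 32 * (\<Sum>k\<in>I j. (\<epsilon> (j, k))\<^sup>2))" and ?d = "card (I j)"
  have comp: "(\<lambda>\<epsilon>. \<epsilon> (j, k)) \<in> borel_measurable (noise \<Lambda>)" if "k \<in> I j" for k
  proof -
    have "(\<lambda>\<epsilon>. \<epsilon> (j, k)) \<in> measurable (noise \<Lambda>) std_normal"
      using that by (intro measurable_component_singleton) (simp add: Lam_def)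
    then show ?thesis by (simp only: measurable_std_normal)
  qed
  have W: "(\<lambda>\<epsilon>. ennreal (?W \<epsilon>)) \<in> borel_measurable (noise \<Lambda>)"
  proof -
    have "(\<lambda>\<epsilon>. \<Sum>k\<in>I j. (\<epsilon> (j, k))\<^sup>2) \<in> borel_measurable (noise \<Lambda>)"
      by (intro borel_measurable_sum borel_measurable_power comp)
    then show ?thesis by measurable
  qed
  show ?thesis
  proof (cases "rough j")
    case True
    then have "(\<integral>\<^sup>+\<epsilon>. ennreal (block_bound \<theta>\<^sub>0 rough j (\<Sum>k\<in>I j. (\<epsilon> (j, k))\<^sup>2)) \<partial>noise \<Lambda>)
      = (\<integral>\<^sup>+\<epsilon>. ennreal (exp (c + G) ^ ?d) * ennreal (?W \<epsilon>) \<partial>noise \<Lambda>)"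
      by (simp add: block_bound_def block_bound_rough_def ennreal_mult)
    also have "\<dots> = ennreal (exp (c + G) ^ ?d) * ennreal ((4 / sqrt 7) ^ ?d)"
      unfolding nn_integral_cmult[OF W] noise_block_moment ..
    also have "\<dots> = ennreal (mean_block_bound \<theta>\<^sub>0 rough j)"
      using True by (simp add: mean_block_bound_def ennreal_mult)
    finally show ?thesis .
  next
    case False
    let ?e = "exp ((\<Sum>k\<in>I j. real n * (\<theta>\<^sub>0 (j, k))\<^sup>2) / 4)"
    have "(\<integral>\<^sup>+\<epsilon>. ennreal (block_bound \<theta>\<^sub>0 rough j (\<Sum>k\<in>I j. (\<epsilon> (j, k))\<^sup>2)) \<partial>noise \<Lambda>)
      = (\<integral>\<^sup>+\<epsilon>. ennreal ?e + ennreal (?e * (3/5) ^ ?d) * ennreal (?W \<epsilon>) \<partial>noise \<Lambda>)"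
    proof (intro nn_integral_cong)
      fix \<epsilon> :: "nat \<times> 'k \<Rightarrow> real"
      have "block_bound \<theta>\<^sub>0 rough j (\<Sum>k\<in>I j. (\<epsilon> (j, k))\<^sup>2) = ?e + ?e * (3/5) ^ ?d * ?W \<epsilon>"
        using False by (simp add: block_bound_def block_bound_smooth_def algebra_simps)
      then show "ennreal (block_bound \<theta>\<^sub>0 rough j (\<Sum>k\<in>I j. (\<epsilon> (j, k))\<^sup>2)) = ennreal ?e + ennreal (?e * (3/5) ^ ?d) * ennreal (?W \<epsilon>)"
        by (simp add: ennreal_mult)
    qed
    also have "\<dots> = (\<integral>\<^sup>+\<epsilon>. ennreal ?e \<partial>noise \<Lambda>) + (\<integral>\<^sup>+\<epsilon>. ennreal (?e * (3/5) ^ ?d) * ennreal (?W \<epsilon>) \<partial>noise \<Lambda>)"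
      by (rule nn_integral_add) (intro borel_measurable_const borel_measurable_times_ennreal W)+
    also have "\<dots> = ennreal ?e + ennreal (?e * (3/5) ^ ?d) * ennreal ((4 / sqrt 7) ^ ?d)"
      unfolding nn_integral_cmult[OF W] noise_block_moment by (simp add: noise.P.emeasure_space_1)
    also have "\<dots> = ennreal (?e + ?e * (3/5) ^ ?d * (4 / sqrt 7) ^ ?d)"
      by (simp add: ennreal_mult)
    also have "?e + ?e * (3/5) ^ ?d * (4 / sqrt 7) ^ ?d = mean_block_bound \<theta>\<^sub>0 rough j"
      using False by (simp add: mean_block_bound_def algebra_simps)
    finally show ?thesis .
  qed
qed

text \<open>Absolute continuity transfers the almost sure bound from the pure noise law to the law at
  \<open>\<theta>\<^sub>0\<close>. Under the latter the bound depends on the noise alone, and different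
  levels are independent.\<close>

lemma expected_posterior_bound:
  fixes \<theta>\<^sub>0 :: "nat \<times> 'k \<Rightarrow> real" and x :: real
  assumes post: "is_posterior prior (obs_space \<Lambda>) (white_noise \<Lambda> n) \<kappa>" and A: "A \<in> sets (param_space \<Lambda>)"
    and ell2: "\<theta>\<^sub>0 \<in> ell2 \<Lambda>"
    and \<theta>\<^sub>0: "\<And>i. i \<in> blocks \<Longrightarrow> \<bar>\<theta>\<^sub>0 i\<bar> \<le> L\<^sub>0 - 1"
    and far: "\<And>\<theta>. \<theta> \<in> A \<Longrightarrow> \<forall>i\<in>\<Lambda> - blocks. \<theta> i = 0 \<Longrightarrow> x \<le> (\<Sum>i\<in>blocks. real n * (\<theta> i - \<theta>\<^sub>0 i)\<^sup>2)"
  shows "(\<integral>\<^sup>+y. emeasure (\<kappa> y) A \<partial>white_noise \<Lambda> n \<theta>\<^sub>0)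
    \<le> ennreal (exp (- x / 64) * (\<Prod>j\<le>J. mean_block_bound \<theta>\<^sub>0 rough j))"
proof -
  let ?B = "\<lambda>j y. ennreal (block_bound \<theta>\<^sub>0 rough j (\<Sum>k\<in>I j. real n * (y (j, k) - \<theta>\<^sub>0 (j, k))\<^sup>2))"
  let ?h = "\<lambda>j \<epsilon>. ennreal (block_bound \<theta>\<^sub>0 rough j (\<Sum>k\<in>I j. (\<epsilon> (j, k))\<^sup>2))"
  let ?K = "\<lambda>j. {j} \<times> I j"
  have ac: "absolutely_continuous noise_only (white_noise \<Lambda> n \<theta>\<^sub>0)"
  proof (rule white_noise_absolutely_continuous)
    show "(\<Sum>i\<in>F. (\<theta>\<^sub>0 i)\<^sup>2) \<le> infsum (\<lambda>i. (\<theta>\<^sub>0 i)\<^sup>2) \<Lambda>" if "finite F" "F \<subseteq> \<Lambda>" for F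
      using ell2 that by (intro finite_sum_le_infsum) (auto simp: ell2_def)
  qed (use n in simp)
  have bb: "(\<lambda>Z. block_bound \<theta>\<^sub>0 rough j Z) \<in> borel_measurable borel" for j
    unfolding block_bound_def block_bound_rough_def block_bound_smooth_def by (cases "rough j") simp_all
  have B_meas: "?B j \<in> borel_measurable (obs_space \<Lambda>)" for j
  proof (intro measurable_compose[OF _ measurable_ennreal] measurable_compose[OF _ bb] borel_measurable_sum
      borel_measurable_times borel_measurable_power borel_measurable_diff borel_measurable_const)
    show "(\<lambda>y. y (j, k)) \<in> borel_measurable (obs_space \<Lambda>)" if "k \<in> I j" for k
      using that by (intro obs_component) (simp add: Lam_def)
  qed
  have prod_meas: "(\<lambda>y. \<Prod>j\<le>J. ?B j y) \<in> borel_measurable (obs_space \<Lambda>)"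
    by (intro borel_measurable_prod_ennreal B_meas)
  have "(\<integral>\<^sup>+y. emeasure (\<kappa> y) A \<partial>white_noise \<Lambda> n \<theta>\<^sub>0)
    \<le> (\<integral>\<^sup>+y. ennreal (exp (- x / 64)) * (\<Prod>j\<le>J. ?B j y) \<partial>white_noise \<Lambda> n \<theta>\<^sub>0)"
  proof (rule nn_integral_mono_AE, rule absolutely_continuous_AE[OF _ ac])
    show "AE y in noise_only. emeasure (\<kappa> y) A \<le> ennreal (exp (- x / 64)) * (\<Prod>j\<le>J. ?B j y)"
      using posterior_bound[OF post A \<theta>\<^sub>0 far, of rough]
      by (simp only: prod_ennreal block_bound_nonneg ennreal_mult'[OF exp_ge_zero])
  qed simp
  also have "\<dots> = ennreal (exp (- x / 64)) * (\<integral>\<^sup>+y. (\<Prod>j\<le>J. ?B j y) \<partial>white_noise \<Lambda> n \<theta>\<^sub>0)"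
    by (rule nn_integral_cmult) (simp only: measurable_white_noise_eq prod_meas)
  also have "(\<integral>\<^sup>+y. (\<Prod>j\<le>J. ?B j y) \<partial>white_noise \<Lambda> n \<theta>\<^sub>0)
    = (\<integral>\<^sup>+\<epsilon>. (\<Prod>j\<le>J. ?B j (observe \<Lambda> n \<theta>\<^sub>0 \<epsilon>)) \<partial>noise \<Lambda>)"
    unfolding white_noise_eq by (rule nn_integral_distr[OF observe_measurable])
      (simp only: measurable_distr_eq1 prod_meas)
  also have "\<dots> = (\<integral>\<^sup>+\<epsilon>. (\<Prod>j\<le>J. ?h j (restrict \<epsilon> (?K j))) \<partial>noise \<Lambda>)"
  proof (intro nn_integral_cong prod.cong refl arg_cong[where f=ennreal] arg_cong[where f="block_bound \<theta>\<^sub>0 rough _"] sum.cong)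
    fix \<epsilon> :: "nat \<times> 'k \<Rightarrow> real" and j k assume k: "k \<in> I j"
    have "real n * (real n powr (-1/2) * \<epsilon> (j, k))\<^sup>2 = (\<epsilon> (j, k))\<^sup>2"
    proof -
      have "(real n powr (-1/2))\<^sup>2 = real n powr (-1)" by (simp add: power2_eq_square powr_add[symmetric])
      also have "\<dots> = 1 / real n" using n by (simp add: powr_minus_divide)
      finally show ?thesis using n by (simp add: power_mult_distrib)
    qed
    then show "real n * (observe \<Lambda> n \<theta>\<^sub>0 \<epsilon> (j, k) - \<theta>\<^sub>0 (j, k))\<^sup>2 = (restrict \<epsilon> (?K j) (j, k))\<^sup>2"
      using k by (simp add: observe_def Lam_def)
  qed
  also have "\<dots> = (\<Prod>j\<le>J. \<integral>\<^sup>+\<epsilon>. ?h j (restrict \<epsilon> (?K j)) \<partial>noise \<Lambda>)"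
  proof (rule noise.nn_integral_PiM_blocks)
    show "?K j \<subseteq> \<Lambda>" for j by (auto simp: Lam_def)
    show "disjoint_family_on ?K {..J}" by (auto simp: disjoint_family_on_def)
    show "?h j \<in> borel_measurable (\<Pi>\<^sub>M i\<in>?K j. std_normal)" for j
    proof (intro measurable_compose[OF _ measurable_ennreal] measurable_compose[OF _ bb] borel_measurable_sum borel_measurable_power)
      fix k assume "k \<in> I j"
      then have "(\<lambda>\<epsilon>. \<epsilon> (j, k)) \<in> measurable (\<Pi>\<^sub>M i\<in>?K j. std_normal) std_normal"
        by (intro measurable_component_singleton) simp
      then show "(\<lambda>\<epsilon>. \<epsilon> (j, k)) \<in> borel_measurable (\<Pi>\<^sub>M i\<in>?K j. std_normal)"
        by (simp only: measurable_std_normal)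
    qed
  qed simp
  also have "\<dots> = (\<Prod>j\<le>J. \<integral>\<^sup>+\<epsilon>. ?h j \<epsilon> \<partial>noise \<Lambda>)"
    by (intro prod.cong refl nn_integral_cong arg_cong[where f=ennreal] arg_cong[where f="block_bound \<theta>\<^sub>0 rough _"] sum.cong) simp
  also have "\<dots> = (\<Prod>j\<le>J. ennreal (mean_block_bound \<theta>\<^sub>0 rough j))"
    by (simp only: mean_block_bound_correct)
  also have "\<dots> = ennreal (\<Prod>j\<le>J. mean_block_bound \<theta>\<^sub>0 rough j)"
    by (intro prod_ennreal) (simp add: mean_block_bound_def)
  finally show ?thesis by (simp only: ennreal_mult'[OF exp_ge_zero])
qed

end

section \<open>Summation over the resolution levels\<close>

lemma sum_pow2_le:
  fixes N :: real
  assumes "finite S" "0 \<le> N" "\<And>j. j \<in> S \<Longrightarrow> 2 ^ j \<le> N"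
  shows "(\<Sum>j\<in>S. 2 ^ j) \<le> 2 * N"
proof (cases "S = {}")
  case False
  let ?m = "Max S"
  have "(\<Sum>j\<in>S. 2 ^ j) \<le> (\<Sum>j<Suc ?m. (2::real) ^ j)"
    using assms(1) by (intro sum_mono2) (auto simp: less_Suc_eq_le)
  also have "\<dots> = 2 ^ Suc ?m - 1" by (subst sum_gp_strict) simp
  also have "\<dots> \<le> 2 * 2 ^ ?m" by simp
  also have "\<dots> \<le> 2 * N" using assms False by simp
  finally show ?thesis .
qed (use assms in simp)

text \<open>A geometric tail starting at frequency \<open>N\<close>, as needed for the energy of a
  Hoelder function.\<close>

lemma sum_powr_tail_le:
  fixes N \<beta> :: real
  assumes "finite S" "0 < N" "0 < \<beta>" "\<And>j. j \<in> S \<Longrightarrow> N \<le> 2 ^ j"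
  shows "(\<Sum>j\<in>S. (2 powr (- 2 * \<beta>)) ^ j) \<le> N powr (- 2 * \<beta>) / (1 - 2 powr (- 2 * \<beta>))"
proof -
  let ?q = "2 powr (- 2 * \<beta>) :: real"
  have q: "0 < ?q" "?q < 1" using assms(3) powr_less_mono[of "- 2 * \<beta>" 0 2] by auto
  show ?thesis
  proof (cases "S = {}")
    case True
    then show ?thesis using q by simp
  next
    case False
    let ?m = "Min S"
    obtain K where K: "S \<subseteq> {..<K}" using assms(1) finite_nat_iff_bounded by blast
    have "(\<Sum>j\<in>S. ?q ^ j) \<le> (\<Sum>j\<in>{?m..<K + ?m}. ?q ^ j)"
      using K assms(1) q by (intro sum_mono2) auto
    also have "\<dots> = ?q ^ ?m * (\<Sum>j<K. ?q ^ j)"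
      using sum.shift_bounds_nat_ivl[of "\<lambda>j. ?q ^ j" 0 ?m K]
      by (simp add: power_add sum_distrib_left mult.commute lessThan_atLeast0 add.commute)
    also have "\<dots> = ?q ^ ?m * ((1 - ?q ^ K) / (1 - ?q))"
      by (simp only: sum_gp_strict less_imp_neq[OF q(2)] if_False)
    also have "\<dots> \<le> ?q ^ ?m * (1 / (1 - ?q))"
      using q by (intro mult_left_mono divide_right_mono) auto
    also have "\<dots> \<le> N powr (- 2 * \<beta>) * (1 / (1 - ?q))"
    proof (intro mult_right_mono)
      have "?q ^ ?m = (2 ^ ?m) powr (- 2 * \<beta>)"
        by (simp add: powr_realpow[symmetric] powr_powr mult.commute)
      also have "\<dots> \<le> N powr (- 2 * \<beta>)"
        using assms False by (intro powr_mono2') auto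
      finally show "?q ^ ?m \<le> N powr (- 2 * \<beta>)" .
    qed (use q in simp)
    finally show ?thesis by simp
  qed
qed

text \<open>From \<open>d * r ^ d \<le> \<Sum>i<d. r ^ i\<close>. This turns decay in the dimension of a
  block into summable decay in its level.\<close>

lemma power_le_inverse_linear:
  fixes r :: real
  assumes "0 \<le> r" "r < 1" "0 < d"
  shows "r ^ d \<le> 1 / (real d * (1 - r))"
proof -
  have "real d * r ^ d = (\<Sum>i<d. r ^ d)" by simp
  also have "\<dots> \<le> (\<Sum>i<d. r ^ i)" using assms by (intro sum_mono power_decreasing) auto
  also have "\<dots> = (1 - r ^ d) / (1 - r)" using assms by (subst sum_gp_strict) simp
  also have "\<dots> \<le> 1 / (1 - r)" using assms by (intro divide_right_mono) auto
  finally show ?thesis using assms by (simp add: field_simps)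
qed

text \<open>The constant \<open>4 / sqrt 7\<close> is the mean of \<open>exp (9 / 32 *
  \<epsilon>\<^sup>2)\<close>.\<close>

lemma sqrt7_ge: "66/25 \<le> sqrt (7::real)"
  by (rule real_le_rsqrt) (simp add: power2_eq_square)

text \<open>A prior with dyadic block sizes and a truth in a Hoelder ball. The lower end
  \<open>\<beta>\<^sub>1\<close> of the range of smoothness enters the constants in place of
  \<open>\<beta>\<close>, which makes them uniform in \<open>\<beta>\<close>.\<close>

locale dyadic_spike_slab_model = spike_slab_model I g L\<^sub>0 G c n
  for I :: "nat \<Rightarrow> 'k set" and g :: "nat \<Rightarrow> ('k \<Rightarrow> real) \<Rightarrow> real" and L\<^sub>0 G c :: real and n :: nat +
  fixes c\<^sub>1 c\<^sub>2 \<beta>\<^sub>1 \<beta> L :: real and \<theta>\<^sub>0 :: "nat \<times> 'k \<Rightarrow> real"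
  assumes c\<^sub>1: "0 < c\<^sub>1" and card_ge: "c\<^sub>1 * 2 ^ j \<le> real (card (I j))"
    and card_le: "real (card (I j)) \<le> c\<^sub>2 * 2 ^ j"
    and \<beta>: "0 < \<beta>\<^sub>1" "\<beta>\<^sub>1 \<le> \<beta>" and L: "0 < L" "L \<le> L\<^sub>0 - 1"
    and holder: "\<theta>\<^sub>0 \<in> holder_ball I \<beta> L"
begin

text \<open>\<open>n\<close> times the squared contraction rate, which is also the order of the number
  of coefficients that matter at smoothness \<open>\<beta>\<close>.\<close>

definition "N = real n powr (1 / (2 * \<beta> + 1))"

abbreviation "q \<equiv> 2 powr (- 2 * \<beta>)"

text \<open>A bound for \<open>n / N\<close> times the energy of the truth at frequencies
  \<open>N\<close> and above.\<close>

definition "T\<^sub>0 = L\<^sup>2 * c\<^sub>2 / (1 - 2 powr (- 2 * \<beta>\<^sub>1))"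

lemma c\<^sub>2_pos: "0 < c\<^sub>2"
  using c\<^sub>1 card_ge[of 0] card_le[of 0] by simp

lemma N: "1 \<le> N" "N \<le> real n" "real n * N powr (- 2 * \<beta>) = N"
proof -
  have n': "1 \<le> real n" using n by simp
  show "1 \<le> N" unfolding N_def using n' \<beta> by (intro ge_one_powr_ge_zero) auto
  have "N \<le> real n powr 1" unfolding N_def using n' \<beta> by (intro powr_mono) auto
  then show "N \<le> real n" using n' by simp
  have "real n * N powr (- 2 * \<beta>) = real n powr 1 * real n powr (1 / (2 * \<beta> + 1) * (- 2 * \<beta>))"
    using n' by (simp add: N_def powr_powr)
  also have "\<dots> = real n powr (1 + 1 / (2 * \<beta> + 1) * (- 2 * \<beta>))" by (rule powr_add[symmetric])
  also have "1 + 1 / (2 * \<beta> + 1) * (- 2 * \<beta>) = 1 / (2 * \<beta> + 1)" using \<beta> by (simp add: field_simps)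
  finally show "real n * N powr (- 2 * \<beta>) = N" by (simp add: N_def)
qed

lemma q: "0 < q" "q < 1"
  using \<beta> powr_less_mono[of "- 2 * \<beta>" 0 2] by auto

text \<open>A coefficient at level \<open>j\<close> has square at most \<open>L\<^sup>2 * q ^ j / 2 ^
  j\<close>, and there are at most \<open>c\<^sub>2 * 2 ^ j\<close> of them.\<close>

lemma block_energy_le: "(\<Sum>k\<in>I j. real n * (\<theta>\<^sub>0 (j, k))\<^sup>2) \<le> real n * L\<^sup>2 * c\<^sub>2 * q ^ j"
proof -
  have "(\<theta>\<^sub>0 (j, k))\<^sup>2 \<le> L\<^sup>2 * (q ^ j / 2 ^ j)" if "k \<in> I j" for k
  proof -
    have "\<bar>\<theta>\<^sub>0 (j, k)\<bar> \<le> L * 2 powr (- real j * (\<beta> + 1/2))"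
      using holder that by (auto simp: holder_ball_def Lam_def)
    then have "(\<theta>\<^sub>0 (j, k))\<^sup>2 \<le> (L * 2 powr (- real j * (\<beta> + 1/2)))\<^sup>2"
      by (rule abs_le_square_iff[THEN iffD1, OF order_trans]) (use L in simp)
    also have "\<dots> = L\<^sup>2 * (2 powr (- 2 * \<beta> * real j) * 2 powr (- real j))"
    proof -
      have "- real j * (\<beta> + 1/2) + - real j * (\<beta> + 1/2) = - 2 * \<beta> * real j + - real j"
        by (simp add: algebra_simps)
      then have "(2 powr (- real j * (\<beta> + 1/2)))\<^sup>2 = 2 powr (- 2 * \<beta> * real j) * 2 powr (- real j)"
        by (simp only: power2_eq_square powr_add[symmetric])
      then show ?thesis by (simp only: power_mult_distrib)
    qed
    also have "2 powr (- 2 * \<beta> * real j) = q ^ j"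
      by (simp add: powr_realpow[symmetric] powr_powr)
    also have "(2::real) powr (- real j) = 1 / 2 ^ j"
      by (simp add: powr_minus_divide powr_realpow)
    finally show ?thesis by simp
  qed
  then have "(\<Sum>k\<in>I j. real n * (\<theta>\<^sub>0 (j, k))\<^sup>2) \<le> (\<Sum>k\<in>I j. real n * (L\<^sup>2 * (q ^ j / 2 ^ j)))"
    by (intro sum_mono mult_left_mono) auto
  also have "\<dots> = real (card (I j)) * (real n * (L\<^sup>2 * (q ^ j / 2 ^ j)))" by simp
  also have "\<dots> \<le> c\<^sub>2 * 2 ^ j * (real n * (L\<^sup>2 * (q ^ j / 2 ^ j)))"
    using q by (intro mult_right_mono card_le) auto
  also have "\<dots> = real n * L\<^sup>2 * c\<^sub>2 * q ^ j" by simp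
  finally show ?thesis .
qed

lemma fine_energy_le:
  assumes "finite S" "\<And>j. j \<in> S \<Longrightarrow> N \<le> 2 ^ j"
  shows "(\<Sum>j\<in>S. real n * L\<^sup>2 * c\<^sub>2 * q ^ j) \<le> T\<^sub>0 * N"
proof -
  have "q \<le> 2 powr (- 2 * \<beta>\<^sub>1)" using \<beta> by (intro powr_mono) auto
  moreover have "2 powr (- 2 * \<beta>\<^sub>1) < (1::real)" using \<beta> powr_less_mono[of "- 2 * \<beta>\<^sub>1" 0 2] by simp
  ultimately have "N powr (- 2 * \<beta>) / (1 - q) \<le> N powr (- 2 * \<beta>) / (1 - 2 powr (- 2 * \<beta>\<^sub>1))"
    using q(2) by (intro divide_left_mono mult_pos_pos) auto
  moreover have "(\<Sum>j\<in>S. q ^ j) \<le> N powr (- 2 * \<beta>) / (1 - q)"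
    using assms N \<beta> by (intro sum_powr_tail_le) auto
  ultimately have "(\<Sum>j\<in>S. q ^ j) \<le> N powr (- 2 * \<beta>) / (1 - 2 powr (- 2 * \<beta>\<^sub>1))" by linarith
  then have "real n * L\<^sup>2 * c\<^sub>2 * (\<Sum>j\<in>S. q ^ j) \<le> real n * L\<^sup>2 * c\<^sub>2 * (N powr (- 2 * \<beta>) / (1 - 2 powr (- 2 * \<beta>\<^sub>1)))"
    using c\<^sub>2_pos by (intro mult_left_mono) auto
  also have "\<dots> = T\<^sub>0 * (real n * N powr (- 2 * \<beta>))" by (simp add: T\<^sub>0_def)
  finally show ?thesis by (simp only: N(3) sum_distrib_left)
qed

text \<open>The levels are cut where the dimension of a block reaches the order \<open>N\<close>: below,
  the cost is proportional to the dimension; above, to the energy of the truth.\<close>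

definition "rough_cost = (c + G + 1) * c\<^sub>2"
definition "rough j \<longleftrightarrow> 2 ^ j \<le> N"

lemma mean_block_bound_rough_le:
  assumes "rough j"
  shows "mean_block_bound \<theta>\<^sub>0 rough j \<le> exp (rough_cost * 2 ^ j)"
proof -
  have "4 / sqrt 7 \<le> 4 / (66/25 :: real)" using sqrt7_ge by (intro divide_left_mono) auto
  also have "\<dots> \<le> exp 1" using exp_ge_add_one_self[of 1] by simp
  finally have "(4 / sqrt 7) ^ card (I j) \<le> exp (1::real) ^ card (I j)" by (intro power_mono) auto
  then have "mean_block_bound \<theta>\<^sub>0 rough j \<le> exp (c + G) ^ card (I j) * exp 1 ^ card (I j)"
    using assms by (simp add: mean_block_bound_def)
  also have "\<dots> = exp ((c + G + 1) * real (card (I j)))"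
    by (simp add: exp_of_nat_mult[symmetric] exp_add[symmetric] algebra_simps)
  also have "\<dots> \<le> exp ((c + G + 1) * (c\<^sub>2 * 2 ^ j))"
    using cG G card_le[of j] by (simp add: mult_left_mono)
  finally show ?thesis by (simp add: rough_cost_def mult.assoc)
qed

lemma mean_block_bound_smooth_le:
  assumes "\<not> rough j"
  shows "mean_block_bound \<theta>\<^sub>0 rough j \<le> exp (real n * L\<^sup>2 * c\<^sub>2 * q ^ j / 4 + 25 / (2 * c\<^sub>1) * (1/2) ^ j)"
proof -
  let ?d = "card (I j)"
  have "3/5 * (4 / sqrt 7) \<le> 3/5 * (4 / (66/25 :: real))"
    using sqrt7_ge by (intro mult_left_mono divide_left_mono) auto
  also have "\<dots> \<le> 23/25" by simp
  finally have "(3/5 * (4 / sqrt 7)) ^ ?d \<le> (23/25 :: real) ^ ?d" by (intro power_mono) auto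
  also have "\<dots> \<le> 1 / (real ?d * (1 - 23/25))"
    using ne[of j] by (intro power_le_inverse_linear) (auto simp: card_gt_0_iff)
  also have "\<dots> \<le> 1 / (c\<^sub>1 * 2 ^ j * (1 - 23/25))"
    using c\<^sub>1 card_ge[of j] ne[of j]
    by (intro divide_left_mono mult_right_mono mult_pos_pos) (auto simp: card_gt_0_iff)
  also have "\<dots> = 25 / (2 * c\<^sub>1) * (1/2) ^ j" by (simp add: power_one_over field_simps)
  finally have "1 + (3/5) ^ ?d * (4 / sqrt 7) ^ ?d \<le> 1 + 25 / (2 * c\<^sub>1) * (1/2) ^ j"
    by (simp only: power_mult_distrib add_le_cancel_left)
  also have "\<dots> \<le> exp (25 / (2 * c\<^sub>1) * (1/2) ^ j)" by (rule exp_ge_add_one_self)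
  finally have "1 + (3/5) ^ ?d * (4 / sqrt 7) ^ ?d \<le> exp (25 / (2 * c\<^sub>1) * (1/2) ^ j)" .
  moreover have "exp ((\<Sum>k\<in>I j. real n * (\<theta>\<^sub>0 (j, k))\<^sup>2) / 4) \<le> exp (real n * L\<^sup>2 * c\<^sub>2 * q ^ j / 4)"
    using block_energy_le[of j] by simp
  ultimately have "exp ((\<Sum>k\<in>I j. real n * (\<theta>\<^sub>0 (j, k))\<^sup>2) / 4) * (1 + (3/5) ^ ?d * (4 / sqrt 7) ^ ?d)
    \<le> exp (real n * L\<^sup>2 * c\<^sub>2 * q ^ j / 4) * exp (25 / (2 * c\<^sub>1) * (1/2) ^ j)"
    by (intro mult_mono) auto
  then show ?thesis using assms by (simp add: mean_block_bound_def exp_add)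
qed

definition "total_cost = 2 * rough_cost + T\<^sub>0 / 4 + 25 / c\<^sub>1"

lemma prod_mean_block_bound_le: "(\<Prod>j\<le>J. mean_block_bound \<theta>\<^sub>0 rough j) \<le> exp (total_cost * N)"
proof -
  let ?e = "\<lambda>j. if rough j then rough_cost * 2 ^ j
    else real n * L\<^sup>2 * c\<^sub>2 * q ^ j / 4 + 25 / (2 * c\<^sub>1) * (1/2) ^ j"
  let ?R = "{..J} \<inter> {j. rough j}" and ?S = "{..J} \<inter> - {j. rough j}"
  have rc: "0 \<le> rough_cost" using cG G c\<^sub>2_pos by (simp add: rough_cost_def)
  have "(\<Prod>j\<le>J. mean_block_bound \<theta>\<^sub>0 rough j) \<le> (\<Prod>j\<le>J. exp (?e j))"
  proof (intro prod_mono conjI)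
    fix j
    show "0 \<le> mean_block_bound \<theta>\<^sub>0 rough j" by (simp add: mean_block_bound_def)
    show "mean_block_bound \<theta>\<^sub>0 rough j \<le> exp (?e j)"
      using mean_block_bound_rough_le[of j] mean_block_bound_smooth_le[of j] by (cases "rough j") simp_all
  qed
  also have "\<dots> = exp (\<Sum>j\<le>J. ?e j)" by (simp add: exp_sum)
  also have "(\<Sum>j\<le>J. ?e j) = rough_cost * (\<Sum>j\<in>?R. 2 ^ j)
      + ((\<Sum>j\<in>?S. real n * L\<^sup>2 * c\<^sub>2 * q ^ j) / 4 + 25 / (2 * c\<^sub>1) * (\<Sum>j\<in>?S. (1/2) ^ j))"
    by (subst sum.If_cases) (simp_all add: sum.distrib sum_distrib_left sum_divide_distrib)
  also have "\<dots> \<le> rough_cost * (2 * N) + (T\<^sub>0 * N / 4 + 25 / (2 * c\<^sub>1) * 2)"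
  proof (intro add_mono mult_left_mono divide_right_mono)
    show "(\<Sum>j\<in>?R. 2 ^ j) \<le> 2 * N" using N by (intro sum_pow2_le) (auto simp: rough_def)
    show "(\<Sum>j\<in>?S. real n * L\<^sup>2 * c\<^sub>2 * q ^ j) \<le> T\<^sub>0 * N"
      by (intro fine_energy_le) (auto simp: rough_def)
    have "(\<Sum>j\<in>?S. (1/2) ^ j) \<le> (\<Sum>j<Suc J. (1/2::real) ^ j)"
      by (intro sum_mono2) (auto simp: less_Suc_eq_le)
    also have "\<dots> = (1 - (1/2) ^ Suc J) / (1 - 1/2)" by (subst sum_gp_strict) simp
    also have "\<dots> \<le> 2" by simp
    finally show "(\<Sum>j\<in>?S. (1/2::real) ^ j) \<le> 2" .
  qed (use rc c\<^sub>1 in auto)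
  also have "\<dots> \<le> rough_cost * (2 * N) + (T\<^sub>0 * N / 4 + 25 / c\<^sub>1 * N)"
    using N c\<^sub>1 by (simp add: field_simps)
  also have "\<dots> = total_cost * N" by (simp add: total_cost_def algebra_simps)
  finally show ?thesis by simp
qed

text \<open>The cut-off level of the prior satisfies \<open>n < 2 ^ (J + 1)\<close>, and \<open>N \<le>
  n\<close>.\<close>

lemma J_gt: "j > J \<Longrightarrow> N \<le> 2 ^ j"
proof -
  assume "j > J"
  have "0 \<le> ln (real n) / ln 2" using n by simp
  then have "ln (real n) / ln 2 < real (J + 1)" unfolding J_max_def by linarith
  then have "ln (real n) < real (J + 1) * ln 2" by (simp add: field_simps)
  also have "\<dots> = ln (2 ^ (J + 1))" by (subst ln_realpow) simp_all
  finally have "real n < 2 ^ (J + 1)" using n by (subst (asm) ln_less_cancel_iff) simp_all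
  also have "(2::real) ^ (J + 1) \<le> 2 ^ j" using \<open>j > J\<close> by (intro power_increasing) auto
  finally have "real n < 2 ^ j" .
  then show ?thesis using N(2) by linarith
qed

lemma tail_energy_le:
  "(\<lambda>i. (\<theta>\<^sub>0 i)\<^sup>2) summable_on (\<Lambda> - blocks)" "real n * (\<Sum>\<^sub>\<infinity>i\<in>\<Lambda> - blocks. (\<theta>\<^sub>0 i)\<^sup>2) \<le> T\<^sub>0 * N"
proof -
  have "(\<lambda>i. (\<theta>\<^sub>0 i)\<^sup>2) summable_on \<Lambda>" using holder by (auto simp: holder_ball_def ell2_def)
  then show s: "(\<lambda>i. (\<theta>\<^sub>0 i)\<^sup>2) summable_on (\<Lambda> - blocks)" by (rule summable_on_subset_banach) auto
  have n0: "0 < real n" using n by simp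
  have "(\<Sum>\<^sub>\<infinity>i\<in>\<Lambda> - blocks. (\<theta>\<^sub>0 i)\<^sup>2) \<le> T\<^sub>0 * N / real n"
  proof (rule infsum_le_finite_sums[OF s])
    fix F assume F: "finite F" "F \<subseteq> \<Lambda> - blocks"
    let ?S = "fst ` F"
    have "(\<Sum>i\<in>F. real n * (\<theta>\<^sub>0 i)\<^sup>2) \<le> (\<Sum>i\<in>Sigma ?S I. real n * (\<theta>\<^sub>0 i)\<^sup>2)"
    proof (intro sum_mono2)
      show "F \<subseteq> Sigma ?S I" using F by (force simp: Lam_def)
    qed (use F in auto)
    also have "\<dots> = (\<Sum>j\<in>?S. \<Sum>k\<in>I j. real n * (\<theta>\<^sub>0 (j, k))\<^sup>2)"
      using F by (subst sum.Sigma) auto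
    also have "\<dots> \<le> (\<Sum>j\<in>?S. real n * L\<^sup>2 * c\<^sub>2 * q ^ j)" by (intro sum_mono block_energy_le)
    also have "\<dots> \<le> T\<^sub>0 * N"
    proof (intro fine_energy_le J_gt)
      show "J < j" if "j \<in> ?S" for j using that F by (fastforce simp: Lam_def)
    qed (use F in auto)
    finally show "(\<Sum>i\<in>F. (\<theta>\<^sub>0 i)\<^sup>2) \<le> T\<^sub>0 * N / real n"
      using n0 by (simp add: sum_distrib_left[symmetric] field_simps)
  qed
  then show "real n * (\<Sum>\<^sub>\<infinity>i\<in>\<Lambda> - blocks. (\<theta>\<^sub>0 i)\<^sup>2) \<le> T\<^sub>0 * N" using n0 by (simp add: field_simps)
qed

lemma T\<^sub>0_nonneg: "0 \<le> T\<^sub>0"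
  using c\<^sub>2_pos \<beta> powr_less_mono[of "- 2 * \<beta>\<^sub>1" 0 2] by (simp add: T\<^sub>0_def)

lemma total_cost_nonneg: "0 \<le> total_cost"
  using T\<^sub>0_nonneg c\<^sub>1 c\<^sub>2_pos cG G by (simp add: total_cost_def rough_cost_def)

definition "radius = sqrt (T\<^sub>0 + 64 * (total_cost + 1))"

text \<open>The prior puts nothing above level \<open>J\<close>, so the distance splits into a part on
  the blocks and the tail energy of the truth, which the term \<open>T\<^sub>0\<close> in the radius
  absorbs.\<close>

lemma distance_on_blocks:
  assumes supp: "\<forall>i\<in>\<Lambda> - blocks. \<theta> i = 0"
    and far: "radius * real n powr (- (\<beta> / (2 * \<beta> + 1))) \<le> ell2_dist \<Lambda> \<theta> \<theta>\<^sub>0"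
  shows "64 * (total_cost + 1) * N \<le> (\<Sum>i\<in>blocks. real n * (\<theta> i - \<theta>\<^sub>0 i)\<^sup>2)"
proof -
  let ?r = "real n powr (- (\<beta> / (2 * \<beta> + 1)))" and ?D = "\<Sum>\<^sub>\<infinity>i\<in>\<Lambda>. (\<theta> i - \<theta>\<^sub>0 i)\<^sup>2"
  have rad: "0 \<le> radius" "radius\<^sup>2 = T\<^sub>0 + 64 * (total_cost + 1)"
    using T\<^sub>0_nonneg total_cost_nonneg by (simp_all add: radius_def)
  have "?D = (\<Sum>\<^sub>\<infinity>i\<in>blocks \<union> (\<Lambda> - blocks). (\<theta> i - \<theta>\<^sub>0 i)\<^sup>2)"
    using blocks(2) by (intro arg_cong[where f="infsum _"]) blast
  also have "\<dots> = (\<Sum>\<^sub>\<infinity>i\<in>blocks. (\<theta> i - \<theta>\<^sub>0 i)\<^sup>2) + (\<Sum>\<^sub>\<infinity>i\<in>\<Lambda> - blocks. (\<theta> i - \<theta>\<^sub>0 i)\<^sup>2)"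
  proof (rule infsum_Un_disjoint)
    show "(\<lambda>i. (\<theta> i - \<theta>\<^sub>0 i)\<^sup>2) summable_on (\<Lambda> - blocks)"
      by (rule summable_on_cong[THEN iffD1, OF _ tail_energy_le(1)]) (use supp in simp)
  qed (auto intro: summable_on_finite)
  also have "(\<Sum>\<^sub>\<infinity>i\<in>\<Lambda> - blocks. (\<theta> i - \<theta>\<^sub>0 i)\<^sup>2) = (\<Sum>\<^sub>\<infinity>i\<in>\<Lambda> - blocks. (\<theta>\<^sub>0 i)\<^sup>2)"
    by (rule infsum_cong) (use supp in simp)
  also have "(\<Sum>\<^sub>\<infinity>i\<in>blocks. (\<theta> i - \<theta>\<^sub>0 i)\<^sup>2) = (\<Sum>i\<in>blocks. (\<theta> i - \<theta>\<^sub>0 i)\<^sup>2)" by simp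
  finally have D: "?D = (\<Sum>i\<in>blocks. (\<theta> i - \<theta>\<^sub>0 i)\<^sup>2) + (\<Sum>\<^sub>\<infinity>i\<in>\<Lambda> - blocks. (\<theta>\<^sub>0 i)\<^sup>2)" .
  have D0: "0 \<le> ?D" by (intro infsum_nonneg) simp
  have "(radius * ?r)\<^sup>2 \<le> (ell2_dist \<Lambda> \<theta> \<theta>\<^sub>0)\<^sup>2" using far rad by (intro power_mono) auto
  also have "\<dots> = ?D" using D0 by (simp add: ell2_dist_def)
  finally have "real n * (radius\<^sup>2 * ?r\<^sup>2) \<le> real n * ?D" by (simp add: power_mult_distrib mult_left_mono)
  moreover have "real n * ?r\<^sup>2 = N"
  proof -
    have "?r\<^sup>2 = N powr (- 2 * \<beta>)"
      by (simp add: N_def powr_powr power2_eq_square powr_add[symmetric] field_simps)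
    then show ?thesis using N(3) by simp
  qed
  moreover have "real n * (radius\<^sup>2 * ?r\<^sup>2) = radius\<^sup>2 * (real n * ?r\<^sup>2)"
    by (rule mult.left_commute)
  ultimately have "radius\<^sup>2 * N \<le> real n * ?D" by (simp only:)
  then have "(T\<^sub>0 + 64 * (total_cost + 1)) * N
      \<le> real n * (\<Sum>i\<in>blocks. (\<theta> i - \<theta>\<^sub>0 i)\<^sup>2) + real n * (\<Sum>\<^sub>\<infinity>i\<in>\<Lambda> - blocks. (\<theta>\<^sub>0 i)\<^sup>2)"
    unfolding rad(2) D by (simp only: distrib_left)
  then show ?thesis using tail_energy_le(2) by (simp add: sum_distrib_left distrib_right)
qed

text \<open>For this radius, the exponent \<open>(total_cost + 1) * N\<close> gained from the distance
  exceeds the cost \<open>total_cost * N\<close> of the blocks by \<open>N\<close>.\<close>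

lemma posterior_contraction:
  assumes post: "is_posterior prior (obs_space \<Lambda>) (white_noise \<Lambda> n) \<kappa>"
  shows "(\<integral>\<^sup>+y. emeasure (\<kappa> y) {\<theta> \<in> ell2 \<Lambda>. ell2_dist \<Lambda> \<theta> \<theta>\<^sub>0 \<ge> radius * real n powr (- (\<beta> / (2 * \<beta> + 1)))}
      \<partial>white_noise \<Lambda> n \<theta>\<^sub>0) \<le> ennreal (exp (- N))"
    (is "(\<integral>\<^sup>+y. emeasure (\<kappa> y) ?A \<partial>_) \<le> _")
proof (cases "?A \<in> sets (param_space \<Lambda>)")
  case True
  have "(\<integral>\<^sup>+y. emeasure (\<kappa> y) ?A \<partial>white_noise \<Lambda> n \<theta>\<^sub>0)
    \<le> ennreal (exp (- (64 * (total_cost + 1) * N) / 64) * (\<Prod>j\<le>J. mean_block_bound \<theta>\<^sub>0 rough j))"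
  proof (rule expected_posterior_bound[OF post True])
    show "\<theta>\<^sub>0 \<in> ell2 \<Lambda>" using holder by (simp add: holder_ball_def)
    show "\<bar>\<theta>\<^sub>0 i\<bar> \<le> L\<^sub>0 - 1" if mem: "i \<in> blocks" for i
    proof -
      obtain j k where i: "i = (j, k)" "k \<in> I j" using mem by auto
      have "\<bar>\<theta>\<^sub>0 i\<bar> \<le> L * 2 powr (- real j * (\<beta> + 1/2))"
        using holder i by (auto simp: holder_ball_def Lam_def)
      also have "\<dots> \<le> L * 2 powr 0" using L \<beta> by (intro mult_left_mono powr_mono) auto
      finally show ?thesis using L by simp
    qed
    show "64 * (total_cost + 1) * N \<le> (\<Sum>i\<in>blocks. real n * (\<theta> i - \<theta>\<^sub>0 i)\<^sup>2)"
      if "\<theta> \<in> ?A" "\<forall>i\<in>\<Lambda> - blocks. \<theta> i = 0" for \<theta>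
      using that by (intro distance_on_blocks) auto
  qed
  also have "\<dots> \<le> ennreal (exp (- (64 * (total_cost + 1) * N) / 64) * exp (total_cost * N))"
    by (intro ennreal_leI mult_left_mono prod_mean_block_bound_le) simp
  also have "exp (- (64 * (total_cost + 1) * N) / 64) * exp (total_cost * N) = exp (- N)"
    by (simp add: exp_add[symmetric] field_simps)
  finally show ?thesis .
next
  case False
  \<comment> \<open>Outside the sigma-algebra \<open>emeasure\<close> takes its default value \<open>0\<close>.\<close>
  have "emeasure (\<kappa> y) ?A = 0" if "y \<in> space (white_noise \<Lambda> n \<theta>\<^sub>0)" for y
  proof -
    have "\<kappa> y \<in> space (prob_algebra prior)"
      using post that measurable_space[of \<kappa> "obs_space \<Lambda>" "prob_algebra prior" y] by (simp add: is_posterior_def)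
    then have "sets (\<kappa> y) = sets (param_space \<Lambda>)" by (simp add: space_prob_algebra)
    then have "?A \<notin> sets (\<kappa> y)" using False by (simp only:) blast
    then show ?thesis by (rule emeasure_notin_sets)
  qed
  then have "(\<integral>\<^sup>+y. emeasure (\<kappa> y) ?A \<partial>white_noise \<Lambda> n \<theta>\<^sub>0) = (\<integral>\<^sup>+y. 0 \<partial>white_noise \<Lambda> n \<theta>\<^sub>0)"
    by (intro nn_integral_cong) simp
  then show ?thesis by simp
qed

end

theorem theorem3p2:
  fixes I :: "nat \<Rightarrow> 'k set"
    and g :: "nat \<Rightarrow> ('k \<Rightarrow> real) \<Rightarrow> real"
    and c\<^sub>1 c\<^sub>2 L\<^sub>0 G c :: real
  assumes "\<And>j. finite (I j)"
    and "0 < c\<^sub>1" and "c\<^sub>1 \<le> c\<^sub>2"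
    and "\<And>j. c\<^sub>1 * 2 ^ j \<le> real (card (I j))"
    and "\<And>j. real (card (I j)) \<le> c\<^sub>2 * 2 ^ j"
    and "0 < L\<^sub>0" and "0 < G" and "4 + G \<le> c"
    and "slab_densities I L\<^sub>0 G g"
  shows "\<forall>\<beta>\<^sub>1 \<beta>\<^sub>2 L :: real. 0 < \<beta>\<^sub>1 \<and> \<beta>\<^sub>1 \<le> \<beta>\<^sub>2 \<and> 0 < L \<and> L \<le> L\<^sub>0 - 1 \<longrightarrow>
    (\<exists>M > 0. \<exists>B > 0. \<forall>\<beta> \<in> {\<beta>\<^sub>1..\<beta>\<^sub>2}. \<forall>n \<ge> (2::nat). \<forall>\<kappa>.
       is_posterior (block_prior I g c n) (obs_space (Lam I)) (white_noise (Lam I) n) \<kappa> \<longrightarrow>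
       (SUP \<theta>\<^sub>0 \<in> holder_ball I \<beta> L.
          \<integral>\<^sup>+ y. emeasure (\<kappa> y)
             {\<theta> \<in> ell2 (Lam I). ell2_dist (Lam I) \<theta> \<theta>\<^sub>0 \<ge> M * real n powr (- (\<beta> / (2 * \<beta> + 1)))}
           \<partial>white_noise (Lam I) n \<theta>\<^sub>0)
       \<le> ennreal (exp (- B * real n powr (1 / (2 * \<beta> + 1)))))"
proof (intro allI impI)
  fix \<beta>\<^sub>1 \<beta>\<^sub>2 L :: real
  assume asm: "0 < \<beta>\<^sub>1 \<and> \<beta>\<^sub>1 \<le> \<beta>\<^sub>2 \<and> 0 < L \<and> L \<le> L\<^sub>0 - 1"
  define T where "T = L\<^sup>2 * c\<^sub>2 / (1 - 2 powr (- 2 * \<beta>\<^sub>1))"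
  define C where "C = 2 * ((c + G + 1) * c\<^sub>2) + T / 4 + 25 / c\<^sub>1"
  define M where "M = sqrt (T + 64 * (C + 1))"
  have "2 powr (- 2 * \<beta>\<^sub>1) < (1::real)" using asm powr_less_mono[of "- 2 * \<beta>\<^sub>1" 0 2] by simp
  then have "0 \<le> T" using assms(2,3) by (simp add: T_def)
  then have "0 < M" using assms by (simp add: M_def C_def add_nonneg_pos add_pos_nonneg)
  have main: "(\<integral>\<^sup>+ y. emeasure (\<kappa> y)
             {\<theta> \<in> ell2 (Lam I). ell2_dist (Lam I) \<theta> \<theta>\<^sub>0 \<ge> M * real n powr (- (\<beta> / (2 * \<beta> + 1)))}
           \<partial>white_noise (Lam I) n \<theta>\<^sub>0) \<le> ennreal (exp (- 1 * real n powr (1 / (2 * \<beta> + 1))))"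
    if "\<beta> \<in> {\<beta>\<^sub>1..\<beta>\<^sub>2}" "2 \<le> n" "is_posterior (block_prior I g c n) (obs_space (Lam I)) (white_noise (Lam I) n) \<kappa>"
      "\<theta>\<^sub>0 \<in> holder_ball I \<beta> L" for \<beta> n \<kappa> \<theta>\<^sub>0
  proof -
    have ne: "I j \<noteq> {}" for j
    proof
      assume "I j = {}"
      then have "c\<^sub>1 * 2 ^ j \<le> 0" using assms(4)[of j] by simp
      moreover have "0 < c\<^sub>1 * 2 ^ j" using assms(2) by simp
      ultimately show False by linarith
    qed
    interpret dyadic_spike_slab_model I g L\<^sub>0 G c n c\<^sub>1 c\<^sub>2 \<beta>\<^sub>1 \<beta> L \<theta>\<^sub>0
    proof unfold_locales
      show "1 \<le> n" using that(2) by simp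
      show "\<beta>\<^sub>1 \<le> \<beta>" using that(1) by simp
      show "0 < \<beta>\<^sub>1" "0 < L" "L \<le> L\<^sub>0 - 1" using asm by simp_all
    qed (rule assms ne that)+
    have "M = radius"
      unfolding M_def C_def T_def radius_def total_cost_def rough_cost_def T\<^sub>0_def ..
    then show ?thesis using posterior_contraction[OF that(3)] by (simp add: N_def)
  qed
  show "\<exists>M > 0. \<exists>B > 0. \<forall>\<beta> \<in> {\<beta>\<^sub>1..\<beta>\<^sub>2}. \<forall>n \<ge> (2::nat). \<forall>\<kappa>.
       is_posterior (block_prior I g c n) (obs_space (Lam I)) (white_noise (Lam I) n) \<kappa> \<longrightarrow>
       (SUP \<theta>\<^sub>0 \<in> holder_ball I \<beta> L.
          \<integral>\<^sup>+ y. emeasure (\<kappa> y)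
             {\<theta> \<in> ell2 (Lam I). ell2_dist (Lam I) \<theta> \<theta>\<^sub>0 \<ge> M * real n powr (- (\<beta> / (2 * \<beta> + 1)))}
           \<partial>white_noise (Lam I) n \<theta>\<^sub>0)
       \<le> ennreal (exp (- B * real n powr (1 / (2 * \<beta> + 1))))"
    by (rule exI[of _ M], rule conjI, rule \<open>0 < M\<close>, rule exI[of _ 1], rule conjI, rule zero_less_one,
        intro ballI allI impI SUP_least, rule main)
qed

end
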